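(* Let $V$ and $W$ be analytic discs attached to the unit sphere, with embedding maps $f$ and $g$ respectively, and suppose that $\mathcal{M}_f=\mathcal{M}_g$ with equivalent norms. If $\xi_1,\ldots,\xi_n\in\mathbb{T}$ form an $n$-point self-crossing, i.e. $f(\xi_1)=\cdots=f(\xi_n)$, then $$[A_f(\xi_1):\ldots:A_f(\xi_n)]=[A_g(\xi_1):\ldots:A_g(\xi_n)],$$ i.e. there is a constant $c>0$ such that $A_f(\xi_j)=c\,A_g(\xi_j)$ for $j=1,\ldots,n$.
   Context: Notation: $\mathbb{D}$ is the open unit disc, $\mathbb{T}$ the unit circle, $\mathbb{B}_d$ the open Euclidean unit ball of $\mathbb{C}^d$, with $\langle z,w\rangle=\sum_j z_j\overline{w_j}$. The Drury-Arveson space $H^2_d$ is the reproducing kernel Hilbert space (RKHS) on $\mathbb{B}_d$ with kernel $\kappa_w(z)=\frac{1}{1-\langle z,w\rangle}$; $\mathcal{M}_d=\operatorname{Mult}(H^2_d)$ is its multiplier algebra. A variety in $\mathbb{B}_d$ is a set of the form $\{z\in\mathbb{B}_d:\varphi(z)=0\ \text{for all}\ \varphi\in E\}$ with $E\subset\mathcal{M}_d$. An analytic disc attached to the unit sphere is a variety $V\subset\mathbb{B}_d$, $d<\infty$, for which there exists an injective analytic map $f:\mathbb{D}\to\mathbb{B}_d$ with $f'(z)\neq 0$ for $z\in\mathbb{D}$, such that $V=f(\mathbb{D})$, $f$ extends to be $C^2$ up to $\overline{\mathbb{D}}$, and for $x\in\overline{\mathbb{D}}$, $\|f(x)\|=1\iff|x|=1$.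 Such an $f$ is called an embedding map of $V$; $f,f'$ also denote the extensions to $\overline{\mathbb{D}}$. For a variety $V$, $\mathcal{H}_V$ is the closed linear span of $\{\kappa_\lambda:\lambda\in V\}$ in $H^2_d$, regarded as an RKHS of functions on $V$, and $\mathcal{M}_V=\{\varphi|_V:\varphi\in\mathcal{M}_d\}$, which equals $\operatorname{Mult}(\mathcal{H}_V)$ and carries the multiplier norm. If $f$ is an embedding map of $V$, then $\mathcal{M}_f=\{\varphi:\mathbb{D}\to\mathbb{C}:\ \varphi\circ f^{-1}\in\mathcal{M}_V\}$ with $\|\varphi\|_{\mathcal{M}_f}=\|\varphi\circ f^{-1}\|_{\mathcal{M}_V}$. For an embedding map $f$, $A_f(\xi)=\langle f(\xi),f'(\xi)\xi\rangle$ for $\xi\in\mathbb{T}$; it is known that $A_f(\xi)>0$ for all $\xi\in\mathbb{T}$. *)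

theory Defs
  imports "HOL-Analysis.Analysis"
begin

text \<open>
  A function on a set \<open>X\<close> is represented by a total function that vanishes off \<open>X\<close>;
  \<open>zext X h\<close> is the restriction of \<open>h\<close> to \<open>X\<close> in this sense.
\<close>

definition zext :: "'a set \<Rightarrow> ('a \<Rightarrow> complex) \<Rightarrow> 'a \<Rightarrow> complex" where
  "zext X h = (\<lambda>x. if x \<in> X then h x else 0)"

section \<open>Reproducing kernel Hilbert spaces and multipliers\<close>

text \<open>Inner products are linear in the first argument.\<close>

record 'a fun_space =
  points :: "'a set"
  elems :: "('a \<Rightarrow> complex) set"
  ip :: "('a \<Rightarrow> complex) \<Rightarrow> ('a \<Rightarrow> complex) \<Rightarrow> complex"

definition hnorm :: "'a fun_space \<Rightarrow> ('a \<Rightarrow> complex) \<Rightarrow> real" where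
  "hnorm S h = sqrt (Re (ip S h h))"

definition inner_fun_space :: "'a fun_space \<Rightarrow> bool" where
  "inner_fun_space S \<longleftrightarrow>
     (\<forall>h\<in>elems S. zext (points S) h = h) \<and>
     (\<lambda>x. 0) \<in> elems S \<and>
     (\<forall>g\<in>elems S. \<forall>h\<in>elems S. (\<lambda>x. g x + h x) \<in> elems S) \<and>
     (\<forall>c. \<forall>h\<in>elems S. (\<lambda>x. c * h x) \<in> elems S) \<and>
     (\<forall>g\<in>elems S. \<forall>h\<in>elems S. \<forall>u\<in>elems S.
        ip S (\<lambda>x. g x + h x) u = ip S g u + ip S h u) \<and>
     (\<forall>c. \<forall>g\<in>elems S. \<forall>h\<in>elems S. ip S (\<lambda>x. c * g x) h = c * ip S g h) \<and>
     (\<forall>g\<in>elems S. \<forall>h\<in>elems S. ip S h g = cnj (ip S g h)) \<and>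
     (\<forall>h\<in>elems S. Re (ip S h h) \<ge> 0) \<and>
     (\<forall>h\<in>elems S. ip S h h = 0 \<longrightarrow> h = (\<lambda>x. 0))"

definition complete_fun_space :: "'a fun_space \<Rightarrow> bool" where
  "complete_fun_space S \<longleftrightarrow>
     (\<forall>s :: nat \<Rightarrow> 'a \<Rightarrow> complex.
        (\<forall>n. s n \<in> elems S) \<longrightarrow>
        (\<forall>e>0. \<exists>N. \<forall>m\<ge>N. \<forall>n\<ge>N. hnorm S (\<lambda>x. s m x - s n x) < e) \<longrightarrow>
        (\<exists>h\<in>elems S. (\<lambda>n. hnorm S (\<lambda>x. s n x - h x)) \<longlonglongrightarrow> 0))"

text \<open>\<open>k w\<close> is the kernel function at \<open>w\<close>.\<close>

definition is_rkhs :: "'a set \<Rightarrow> ('a \<Rightarrow> 'a \<Rightarrow> complex) \<Rightarrow> 'a fun_space \<Rightarrow> bool" where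
  "is_rkhs X k S \<longleftrightarrow>
     points S = X \<and> inner_fun_space S \<and> complete_fun_space S \<and>
     (\<forall>w\<in>X. zext X (k w) \<in> elems S \<and> (\<forall>h\<in>elems S. ip S h (zext X (k w)) = h w))"

definition multipliers :: "'a fun_space \<Rightarrow> ('a \<Rightarrow> complex) set" where
  "multipliers S = {\<phi>. zext (points S) \<phi> = \<phi> \<and> (\<forall>h\<in>elems S. (\<lambda>x. \<phi> x * h x) \<in> elems S)}"

text \<open>
  The operator norm of multiplication by \<open>\<phi>\<close>. It is finite on multipliers of a reproducing
  kernel Hilbert space by the closed graph theorem; the type \<^typ>\<open>ennreal\<close> only spares the
  definition a boundedness side condition.
\<close>

definition mult_norm :: "'a fun_space \<Rightarrow> ('a \<Rightarrow> complex) \<Rightarrow> ennreal" where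
  "mult_norm S \<phi> =
     (SUP h\<in>{h \<in> elems S. hnorm S h \<le> 1}. ennreal (hnorm S (\<lambda>x. \<phi> x * h x)))"

section \<open>The Drury-Arveson space\<close>

definition herm :: "complex ^ 'd \<Rightarrow> complex ^ 'd \<Rightarrow> complex" where
  "herm z w = (\<Sum>j\<in>UNIV. z $ j * cnj (w $ j))"

definition da_kernel :: "complex ^ 'd \<Rightarrow> complex ^ 'd \<Rightarrow> complex" where
  "da_kernel w z = 1 / (1 - herm z w)"

text \<open>
  The reproducing kernel Hilbert space with this kernel exists, the kernel being positive
  definite (Moore-Aronszajn). The kernel determines the elements and the values of the inner
  product on them, so the choice only concerns irrelevant values of \<open>ip\<close> outside \<open>elems\<close>.
\<close>

definition drury_arveson :: "(complex ^ 'd) fun_space" where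
  "drury_arveson = (SOME S. is_rkhs (ball 0 1) da_kernel S)"

definition da_multipliers :: "(complex ^ 'd \<Rightarrow> complex) set" where
  "da_multipliers = multipliers drury_arveson"

definition variety :: "(complex ^ 'd) set \<Rightarrow> bool" where
  "variety V \<longleftrightarrow> (\<exists>E \<subseteq> da_multipliers. V = {z \<in> ball 0 1. \<forall>\<phi>\<in>E. \<phi> z = 0})"

definition kernel_span :: "(complex ^ 'd) set \<Rightarrow> (complex ^ 'd \<Rightarrow> complex) set" where
  "kernel_span V =
     {h. \<exists>A a. finite A \<and> A \<subseteq> V \<and> h = (\<lambda>z. \<Sum>w\<in>A. a w * zext (ball 0 1) (da_kernel w) z)}"

definition closed_kernel_span :: "(complex ^ 'd) set \<Rightarrow> (complex ^ 'd \<Rightarrow> complex) set" where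
  "closed_kernel_span V =
     {h \<in> elems drury_arveson.
        \<forall>e>0. \<exists>g\<in>kernel_span V. hnorm drury_arveson (\<lambda>z. h z - g z) < e}"

text \<open>
  The closed span regarded as a space of functions on \<open>V\<close>: restriction to \<open>V\<close> is injective
  on it, since an element vanishing on \<open>V\<close> is orthogonal to all kernel functions at points
  of \<open>V\<close>, and the inner product is carried over along this bijection.
\<close>

definition H_on :: "(complex ^ 'd) set \<Rightarrow> (complex ^ 'd) fun_space" where
  "H_on V =
     (let lift = the_inv_into (closed_kernel_span V) (zext V) in
      \<lparr> points = V,
        elems = zext V ` closed_kernel_span V,
        ip = (\<lambda>g h. ip drury_arveson (lift g) (lift h)) \<rparr>)"

definition M_on :: "(complex ^ 'd) set \<Rightarrow> (complex ^ 'd \<Rightarrow> complex) set" where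
  "M_on V = zext V ` da_multipliers"

definition M_on_norm :: "(complex ^ 'd) set \<Rightarrow> (complex ^ 'd \<Rightarrow> complex) \<Rightarrow> ennreal" where
  "M_on_norm V \<phi> = mult_norm (H_on V) \<phi>"

section \<open>Analytic discs attached to the unit sphere\<close>

definition vderiv :: "(complex \<Rightarrow> complex ^ 'd) \<Rightarrow> complex \<Rightarrow> complex ^ 'd" where
  "vderiv f z = (\<chi> j. deriv (\<lambda>w. f w $ j) z)"

text \<open>
  A map on the disc that extends to the closed disc is represented by its extension. Its
  derivative at boundary points is the limit of the derivative from inside the open disc.
\<close>

definition vderiv_ext :: "(complex \<Rightarrow> complex ^ 'd) \<Rightarrow> complex \<Rightarrow> complex ^ 'd" where
  "vderiv_ext f z = (if z \<in> ball 0 1 then vderiv f z else Lim (at z within ball 0 1) (vderiv f))"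

text \<open>
  For a holomorphic map, all real partial derivatives of order \<open>k\<close> are unimodular constants
  times the \<open>k\<close>-th complex derivative, so being \<open>C\<^sup>2\<close> up to the boundary means that the
  complex derivatives of order at most two extend continuously to the closed disc.
\<close>

definition C2_up_to_boundary :: "(complex \<Rightarrow> complex ^ 'd) \<Rightarrow> bool" where
  "C2_up_to_boundary f \<longleftrightarrow>
     continuous_on (cball 0 1) f \<and>
     (\<exists>f1. continuous_on (cball 0 1) f1 \<and> (\<forall>z\<in>ball 0 1. f1 z = vderiv f z)) \<and>
     (\<exists>f2. continuous_on (cball 0 1) f2 \<and> (\<forall>z\<in>ball 0 1. f2 z = vderiv (vderiv f) z))"

definition disc_embedding :: "(complex ^ 'd) set \<Rightarrow> (complex \<Rightarrow> complex ^ 'd) \<Rightarrow> bool" where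
  "disc_embedding V f \<longleftrightarrow>
     f \<in> ball 0 1 \<rightarrow> ball 0 1 \<and>
     inj_on f (ball 0 1) \<and>
     (\<forall>j. (\<lambda>z. f z $ j) holomorphic_on ball 0 1) \<and>
     (\<forall>z\<in>ball 0 1. vderiv f z \<noteq> 0) \<and>
     V = f ` ball 0 1 \<and>
     C2_up_to_boundary f \<and>
     (\<forall>x\<in>cball 0 1. norm (f x) = 1 \<longleftrightarrow> norm x = 1)"

definition attached_disc :: "(complex ^ 'd) set \<Rightarrow> bool" where
  "attached_disc V \<longleftrightarrow> variety V \<and> (\<exists>f. disc_embedding V f)"

text \<open>\<open>\<phi> \<circ> f\<^sup>-\<^sup>1\<close> as a function on the image of the open unit disc.\<close>

definition transport :: "(complex \<Rightarrow> complex ^ 'd) \<Rightarrow> (complex \<Rightarrow> complex) \<Rightarrow> complex ^ 'd \<Rightarrow> complex"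
  where "transport f \<phi> = zext (f ` ball 0 1) (\<phi> \<circ> the_inv_into (ball 0 1) f)"

definition M_emb :: "(complex \<Rightarrow> complex ^ 'd) \<Rightarrow> (complex \<Rightarrow> complex) set" where
  "M_emb f = {\<phi>. zext (ball 0 1) \<phi> = \<phi> \<and> transport f \<phi> \<in> M_on (f ` ball 0 1)}"

definition M_emb_norm :: "(complex \<Rightarrow> complex ^ 'd) \<Rightarrow> (complex \<Rightarrow> complex) \<Rightarrow> ennreal" where
  "M_emb_norm f \<phi> = M_on_norm (f ` ball 0 1) (transport f \<phi>)"

definition equivalent_norms_on :: "'b set \<Rightarrow> ('b \<Rightarrow> ennreal) \<Rightarrow> ('b \<Rightarrow> ennreal) \<Rightarrow> bool" where
  "equivalent_norms_on M N1 N2 \<longleftrightarrow>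
     (\<exists>a b :: real. 0 < a \<and> 0 < b \<and>
        (\<forall>x\<in>M. ennreal a * N1 x \<le> N2 x \<and> N2 x \<le> ennreal b * N1 x))"

definition crossing_coeff :: "(complex \<Rightarrow> complex ^ 'd) \<Rightarrow> complex \<Rightarrow> complex" where
  "crossing_coeff f \<xi> = herm (f \<xi>) (\<xi> *s vderiv_ext f \<xi>)"

end

theory Submission
  imports Defs "HOL-Complex_Analysis.Conformal_Mappings"
begin

text \<open>
  The proof compares two points at a time. On the side of \<open>V\<close>, a multiplier that vanishes at
  \<open>y\<close> has at \<open>x\<close> at most the modulus \<open>\<rho>(x, y)\<close> times its norm. Here \<open>\<rho>\<close> is the pseudohyperbolic distance
  of the ball, given by
  \<open>1 - \<rho>\<^sup>2 = (1 - |x|\<^sup>2) (1 - |y|\<^sup>2) / |1 - \<langle>x, y\<rangle>|\<^sup>2\<close> (\<open>two_point_estimate\<close>). On the side of \<open>W\<close>, each function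
  \<open>v \<mapsto> (\<langle>v, q\<rangle> - \<alpha>) / (1 - cnj \<alpha> \<langle>v, q\<rangle>)\<close> with \<open>|q| \<le> 1\<close> and \<open>|\<alpha>| < 1\<close> is a multiplier of norm at
  most one (\<open>schur_multiplier_M_on\<close>), and \<open>\<alpha> = \<langle>g y, q\<rangle>\<close> makes it vanish at \<open>g y\<close>. Since the two
  norms are comparable, these test functions must tend to zero at \<open>g x\<close> along all pairs \<open>x, y\<close>
  with \<open>\<rho>(f x, f y) \<rightarrow> 0\<close> (\<open>pseudohyperbolic_comparison\<close>).

  Let \<open>f \<xi> = f \<eta>\<close> be a crossing and let \<open>x = (1 - s t) \<xi>\<close> and \<open>y = (1 - t) \<eta>\<close> with \<open>t \<rightarrow> 0\<close>. To first
  order, \<open>1 - \<langle>f x, f y\<rangle> \<sim> t (s A\<^sub>f(\<xi>) + A\<^sub>f(\<eta>))\<close>, and likewise for \<open>1 - |f x|\<^sup>2\<close> and \<open>1 - |f y|\<^sup>2\<close>,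
  so that \<open>1 - \<rho>\<^sup>2\<close> tends to \<open>4 s A\<^sub>f(\<xi>) A\<^sub>f(\<eta>) / (s A\<^sub>f(\<xi>) + A\<^sub>f(\<eta>))\<^sup>2\<close>. By the inequality of
  arithmetic and geometric means this limit is one exactly for \<open>s = A\<^sub>f(\<eta>) / A\<^sub>f(\<xi>)\<close>. For this
  speed the test function with \<open>q = g \<eta>\<close> tends to zero. But its limit is \<open>-1\<close> if \<open>g \<xi> \<noteq> g \<eta>\<close>, and
  \<open>(A\<^sub>g(\<eta>) - s A\<^sub>g(\<xi>)) / (A\<^sub>g(\<eta>) + s A\<^sub>g(\<xi>))\<close> if \<open>g \<xi> = g \<eta>\<close>. So \<open>g\<close> crosses itself at the same points
  and \<open>A\<^sub>g(\<eta>) / A\<^sub>g(\<xi>) = s\<close> (\<open>crossing_coeff_proportional\<close>).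

  Three general facts support this. The Drury-Arveson space is obtained from the feature map
  \<open>z \<mapsto> (\<Prod>j\<leftarrow>w. cnj z\<^sub>j)\<^sub>w\<close> into the square-summable families over words (the full Fock space).
  A Riesz representation theorem phrased for graphs (\<open>riesz_graph\<close>) yields at once orthogonal
  projections onto closed spans of kernel functions and the criterion that positivity of
  \<open>(1 - \<phi>(u) cnj \<phi>(w)) k(u, w)\<close> makes \<open>\<phi>\<close> a contractive multiplier. Finally, \<open>A\<^sub>f > 0\<close> holds
  because \<open>z \<mapsto> \<langle>f z, f \<xi>\<rangle>\<close> maps the disc into itself and \<open>\<xi>\<close> to one: its inward derivatives in
  all directions have the right sign, and the Schwarz lemma bounds the radial one away from zero.
\<close>

section \<open>Hilbert spaces of functions\<close>

locale inner_space =
  fixes S :: "'a fun_space"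
  assumes inner: "inner_fun_space S"
begin

lemma zext_elem: "h \<in> elems S \<Longrightarrow> zext (points S) h = h"
  using inner unfolding inner_fun_space_def by blast

lemma zero_in [simp]: "(\<lambda>x. 0) \<in> elems S"
  using inner unfolding inner_fun_space_def by blast

lemma add_in: "g \<in> elems S \<Longrightarrow> h \<in> elems S \<Longrightarrow> (\<lambda>x. g x + h x) \<in> elems S"
  using inner unfolding inner_fun_space_def by blast

lemma scale_in: "h \<in> elems S \<Longrightarrow> (\<lambda>x. c * h x) \<in> elems S"
  using inner unfolding inner_fun_space_def by blast

lemma diff_in: "g \<in> elems S \<Longrightarrow> h \<in> elems S \<Longrightarrow> (\<lambda>x. g x - h x) \<in> elems S"
  using add_in[OF _ scale_in[of h "-1"], of g] by simp

lemma ip_add_left: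
  "g \<in> elems S \<Longrightarrow> h \<in> elems S \<Longrightarrow> u \<in> elems S \<Longrightarrow>
    ip S (\<lambda>x. g x + h x) u = ip S g u + ip S h u"
  using inner unfolding inner_fun_space_def by blast

lemma ip_scale_left:
  "g \<in> elems S \<Longrightarrow> h \<in> elems S \<Longrightarrow> ip S (\<lambda>x. c * g x) h = c * ip S g h"
  using inner unfolding inner_fun_space_def by blast

lemma ip_commute: "g \<in> elems S \<Longrightarrow> h \<in> elems S \<Longrightarrow> ip S g h = cnj (ip S h g)"
  using inner unfolding inner_fun_space_def by blast

lemma ip_diff_left:
  "g \<in> elems S \<Longrightarrow> h \<in> elems S \<Longrightarrow> u \<in> elems S \<Longrightarrow>
    ip S (\<lambda>x. g x - h x) u = ip S g u - ip S h u"
  using ip_add_left[OF _ scale_in[of h "-1"], of g u] ip_scale_left[of h u "-1"] by simp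

lemma ip_add_right:
  assumes "g \<in> elems S" "h \<in> elems S" "u \<in> elems S"
  shows "ip S u (\<lambda>x. g x + h x) = ip S u g + ip S u h"
  using assms ip_commute[of u "\<lambda>x. g x + h x"] ip_commute[of u g] ip_commute[of u h]
  by (simp add: add_in ip_add_left)

lemma ip_diff_right:
  assumes "g \<in> elems S" "h \<in> elems S" "u \<in> elems S"
  shows "ip S u (\<lambda>x. g x - h x) = ip S u g - ip S u h"
  using assms ip_commute[of u "\<lambda>x. g x - h x"] ip_commute[of u g] ip_commute[of u h]
  by (simp add: diff_in ip_diff_left)

lemma ip_scale_right:
  assumes "g \<in> elems S" "u \<in> elems S"
  shows "ip S u (\<lambda>x. c * g x) = cnj c * ip S u g"
  using assms ip_commute[of u "\<lambda>x. c * g x"] ip_commute[of u g]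
  by (simp add: scale_in ip_scale_left)

lemmas ip_left = ip_add_left ip_diff_left ip_scale_left
lemmas ip_right = ip_add_right ip_diff_right ip_scale_right
lemmas in_elems = add_in diff_in scale_in

lemma ip_self: "h \<in> elems S \<Longrightarrow> ip S h h = of_real ((hnorm S h)\<^sup>2)"
proof -
  assume h: "h \<in> elems S"
  have "Re (ip S h h) \<ge> 0"
    using inner h unfolding inner_fun_space_def by blast
  moreover have "Im (ip S h h) = Im (cnj (ip S h h))"
    by (rule arg_cong[OF ip_commute[OF h h]])
  ultimately show ?thesis
    by (simp add: hnorm_def complex_eq_iff)
qed

lemma hnorm_nonneg [simp]: "h \<in> elems S \<Longrightarrow> hnorm S h \<ge> 0"
  unfolding hnorm_def real_sqrt_ge_0_iff using inner unfolding inner_fun_space_def by blast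

lemma hnorm_sq: "h \<in> elems S \<Longrightarrow> (hnorm S h)\<^sup>2 = Re (ip S h h)"
  using ip_self by simp

lemma hnorm_eq_0: 
  assumes "h \<in> elems S" "hnorm S h = 0"
  shows "h = (\<lambda>x. 0)"
proof -
  have "ip S h h = 0" using ip_self assms by simp
  then show ?thesis using inner assms(1) unfolding inner_fun_space_def by blast
qed

lemma ip_zero_left [simp]: "h \<in> elems S \<Longrightarrow> ip S (\<lambda>x. 0) h = 0"
  using ip_scale_left[of h h 0] by simp

lemma ip_zero_right [simp]: "h \<in> elems S \<Longrightarrow> ip S h (\<lambda>x. 0) = 0"
  using ip_scale_right[of h h 0] by simp

lemma hnorm_zero [simp]: "hnorm S (\<lambda>x. 0) = 0"
  by (simp add: hnorm_def)

lemma hnorm_sq_add: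
  assumes "g \<in> elems S" "h \<in> elems S"
  shows "(hnorm S (\<lambda>x. g x + h x))\<^sup>2 = (hnorm S g)\<^sup>2 + 2 * Re (ip S g h) + (hnorm S h)\<^sup>2"
  using assms ip_commute[of h g] by (simp add: hnorm_sq in_elems ip_left ip_right)

lemma hnorm_sq_diff:
  assumes "g \<in> elems S" "h \<in> elems S"
  shows "(hnorm S (\<lambda>x. g x - h x))\<^sup>2 = (hnorm S g)\<^sup>2 - 2 * Re (ip S g h) + (hnorm S h)\<^sup>2"
  using assms ip_commute[of h g] by (simp add: hnorm_sq in_elems ip_left ip_right)

lemma hnorm_scale:
  assumes "h \<in> elems S"
  shows "hnorm S (\<lambda>x. c * h x) = cmod c * hnorm S h"
proof -
  have "ip S (\<lambda>x. c * h x) (\<lambda>x. c * h x) = c * cnj c * ip S h h"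
    using assms by (simp add: ip_left ip_right scale_in)
  also have "\<dots> = of_real ((cmod c * hnorm S h)\<^sup>2)"
    by (simp only: ip_self[OF assms] complex_norm_square[symmetric] power_mult_distrib of_real_mult
        of_real_power)
  finally have "(hnorm S (\<lambda>x. c * h x))\<^sup>2 = (cmod c * hnorm S h)\<^sup>2"
    unfolding hnorm_sq[OF scale_in[OF assms]] by simp
  then show ?thesis
    using assms by (simp add: scale_in)
qed

lemma cauchy_schwarz:
  assumes g: "g \<in> elems S" and h: "h \<in> elems S"
  shows "cmod (ip S g h) \<le> hnorm S g * hnorm S h"
proof (cases "hnorm S h = 0")
  case True
  then show ?thesis using hnorm_eq_0[OF h True] g by simp
next
  case False
  define N where "N = hnorm S h"
  have N: "N > 0" using False hnorm_nonneg[OF h] by (simp add: N_def)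
  define c where "c = ip S g h / of_real (N\<^sup>2)"
  have "0 \<le> (hnorm S (\<lambda>x. g x - c * h x))\<^sup>2" by simp
  also have "\<dots> = (hnorm S g)\<^sup>2 - 2 * Re (cnj c * ip S g h) + (cmod c * N)\<^sup>2"
    using g h by (simp add: hnorm_sq_diff scale_in ip_scale_right hnorm_scale N_def)
  also have "cnj c * ip S g h = of_real ((cmod (ip S g h))\<^sup>2 / N\<^sup>2)"
    by (simp add: c_def complex_norm_square[symmetric] mult.commute)
  also have "(cmod c * N)\<^sup>2 = (cmod (ip S g h))\<^sup>2 / N\<^sup>2"
    using N by (simp add: c_def norm_divide power2_eq_square norm_mult)
  finally have "(cmod (ip S g h))\<^sup>2 / N\<^sup>2 \<le> (hnorm S g)\<^sup>2" by simp
  then have "(cmod (ip S g h))\<^sup>2 \<le> (hnorm S g * N)\<^sup>2"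
    using N by (simp add: field_simps power_mult_distrib)
  then show ?thesis
    using N g by (metis N_def abs_le_square_iff abs_of_nonneg hnorm_nonneg h mult_nonneg_nonneg norm_ge_zero)
qed

lemma hnorm_triangle:
  assumes g: "g \<in> elems S" and h: "h \<in> elems S"
  shows "hnorm S (\<lambda>x. g x + h x) \<le> hnorm S g + hnorm S h"
proof -
  have "(hnorm S (\<lambda>x. g x + h x))\<^sup>2 \<le> (hnorm S g + hnorm S h)\<^sup>2"
    using hnorm_sq_add[OF g h] cauchy_schwarz[OF g h] complex_Re_le_cmod[of "ip S g h"]
    by (simp add: power2_sum)
  then show ?thesis
    by (rule power2_le_imp_le) (simp add: g h)
qed

lemma hnorm_diff_commute:
  assumes "g \<in> elems S" "h \<in> elems S"
  shows "hnorm S (\<lambda>x. g x - h x) = hnorm S (\<lambda>x. h x - g x)"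
  using hnorm_scale[OF diff_in[OF assms], of "-1"] by simp

lemma sum_in:
  "finite A \<Longrightarrow> (\<And>w. w \<in> A \<Longrightarrow> h w \<in> elems S) \<Longrightarrow> (\<lambda>x. \<Sum>w\<in>A. h w x) \<in> elems S"
  by (induction A rule: finite_induct) (auto simp: add_in)

lemma ip_sum_left:
  assumes "finite A" "\<And>w. w \<in> A \<Longrightarrow> h w \<in> elems S" "u \<in> elems S"
  shows "ip S (\<lambda>x. \<Sum>w\<in>A. h w x) u = (\<Sum>w\<in>A. ip S (h w) u)"
  using assms
  by (induction A rule: finite_induct) (simp_all add: ip_add_left sum_in)

lemma ip_sum_right:
  assumes "finite A" "\<And>w. w \<in> A \<Longrightarrow> h w \<in> elems S" "u \<in> elems S"
  shows "ip S u (\<lambda>x. \<Sum>w\<in>A. h w x) = (\<Sum>w\<in>A. ip S u (h w))"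
  using assms
  by (induction A rule: finite_induct) (simp_all add: ip_add_right sum_in)

lemma ip_tendsto_left:
  assumes s: "\<And>n. s n \<in> elems S" and u: "u \<in> elems S" and h: "h \<in> elems S"
    and lim: "(\<lambda>n::nat. hnorm S (\<lambda>x. s n x - u x)) \<longlonglongrightarrow> 0"
  shows "(\<lambda>n. ip S (s n) h) \<longlonglongrightarrow> ip S u h"
proof -
  have "(\<lambda>n. hnorm S (\<lambda>x. s n x - u x) * hnorm S h) \<longlonglongrightarrow> 0 * hnorm S h"
    by (intro tendsto_intros lim)
  then have "(\<lambda>n. hnorm S (\<lambda>x. s n x - u x) * hnorm S h) \<longlonglongrightarrow> 0" by simp
  then have "(\<lambda>n. ip S (s n) h - ip S u h) \<longlonglongrightarrow> 0"
    by (rule Lim_null_comparison[rotated])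
      (use cauchy_schwarz[OF diff_in[OF s u] h] in \<open>simp add: ip_diff_left s u h\<close>)
  then show ?thesis by (simp add: LIM_zero_iff)
qed

lemma ip_tendsto_right:
  assumes s: "\<And>n. s n \<in> elems S" and u: "u \<in> elems S" and h: "h \<in> elems S"
    and lim: "(\<lambda>n::nat. hnorm S (\<lambda>x. s n x - u x)) \<longlonglongrightarrow> 0"
  shows "(\<lambda>n. ip S h (s n)) \<longlonglongrightarrow> ip S h u"
  using tendsto_cnj[OF ip_tendsto_left[OF assms]] ip_commute[OF h u] ip_commute[OF h s] by simp

lemma hnorm_tendsto:
  assumes s: "\<And>n. s n \<in> elems S" and u: "u \<in> elems S"
    and lim: "(\<lambda>n::nat. hnorm S (\<lambda>x. s n x - u x)) \<longlonglongrightarrow> 0"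
  shows "(\<lambda>n. hnorm S (s n)) \<longlonglongrightarrow> hnorm S u"
proof -
  have "norm (hnorm S (s n) - hnorm S u) \<le> hnorm S (\<lambda>x. s n x - u x)" for n
    using hnorm_triangle[OF diff_in[OF s u] u, of n] hnorm_triangle[OF diff_in[OF u s] s, of n n]
      hnorm_diff_commute[OF s u, of n] by (simp add: abs_le_iff)
  then have "(\<lambda>n. hnorm S (s n) - hnorm S u) \<longlonglongrightarrow> 0"
    by (intro Lim_null_comparison[OF _ lim]) simp
  then show ?thesis by (simp add: LIM_zero_iff)
qed

end

locale complete_inner_space = inner_space +
  assumes complete: "complete_fun_space S"
begin

text \<open>
  A bounded linear functional is given here by its graph \<open>P\<close>, a set of pairs of a vector and a
  value, so that a functional prescribed on linear combinations of kernel functions needs no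
  separate argument for being well defined. The representing vector minimizes
  \<open>\<parallel>v\<parallel>\<^sup>2 - 2 Re c\<close> over the graph: by the parallelogram law a minimizing sequence is Cauchy, and
  the variation at the minimum is the representation property.
\<close>

lemma riesz_graph:
  fixes P :: "(('a \<Rightarrow> complex) \<times> complex) set"
  assumes zero: "(\<lambda>x. 0, 0) \<in> P"
    and elem: "\<And>v c. (v, c) \<in> P \<Longrightarrow> v \<in> elems S"
    and add: "\<And>v c v' c'. (v, c) \<in> P \<Longrightarrow> (v', c') \<in> P \<Longrightarrow> (\<lambda>x. v x + v' x, c + c') \<in> P"
    and scale: "\<And>v c t. (v, c) \<in> P \<Longrightarrow> (\<lambda>x. t * v x, t * c) \<in> P"
    and bound: "\<And>v c. (v, c) \<in> P \<Longrightarrow> cmod c \<le> C * hnorm S v"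
    and C: "C \<ge> 0"
  obtains u where "u \<in> elems S" "\<And>v c. (v, c) \<in> P \<Longrightarrow> ip S v u = c" "hnorm S u \<le> C"
    "\<And>e. e > 0 \<Longrightarrow> \<exists>v c. (v, c) \<in> P \<and> hnorm S (\<lambda>x. u x - v x) < e"
proof -
  define J where "J = (\<lambda>(v, c). (hnorm S v)\<^sup>2 - 2 * Re c)"
  have J_lower: "J p \<ge> - C\<^sup>2" if "p \<in> P" for p
  proof -
    obtain v c where p: "p = (v, c)" by force
    have "0 \<le> (hnorm S v - C)\<^sup>2" by simp
    moreover have "Re c \<le> C * hnorm S v"
      using bound[of v c] that p complex_Re_le_cmod[of c] by simp
    ultimately show ?thesis by (simp add: J_def p power2_diff algebra_simps)
  qed
  define m where "m = Inf (J ` P)"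
  have bdd: "bdd_below (J ` P)" using J_lower by (intro bdd_belowI2)
  have m_le: "m \<le> J p" if "p \<in> P" for p
    unfolding m_def using bdd that by (intro cInf_lower) auto
  have "\<exists>p\<in>P. J p < m + 1 / real (Suc n)" for n
  proof -
    have "Inf (J ` P) < m + 1 / real (Suc n)" by (simp add: m_def)
    then show ?thesis using cInf_lessD[of "J ` P"] zero by blast
  qed
  then obtain p where pP: "\<And>n. p n \<in> P" and pJ: "\<And>n. J (p n) < m + 1 / real (Suc n)"
    by metis
  define v where "v = (\<lambda>n. fst (p n))"
  define c where "c = (\<lambda>n. snd (p n))"
  have vc: "(v n, c n) \<in> P" for n using pP by (simp add: v_def c_def)
  have v_in [simp]: "v n \<in> elems S" for n using elem[OF vc] .
  have Jn: "(hnorm S (v n))\<^sup>2 - 2 * Re (c n) < m + 1 / real (Suc n)" for n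
    using pJ[of n] by (simp add: J_def v_def c_def split_beta)
  have Jge: "m \<le> (hnorm S w)\<^sup>2 - 2 * Re d" if "(w, d) \<in> P" for w d
    using m_le[OF that] by (simp add: J_def)
  \<comment> \<open>The midpoint of two graph points is again in the graph, where \<open>J \<ge> m\<close>.\<close>
  have gap: "(hnorm S (\<lambda>x. v k x - v n x))\<^sup>2 \<le> 2 * (1 / real (Suc k) + 1 / real (Suc n))" for k n
  proof -
    have "(\<lambda>x. (1/2) * (v k x + v n x), (1/2) * (c k + c n)) \<in> P"
      by (intro scale add vc)
    from Jge[OF this]
    have "m \<le> (1/4) * (hnorm S (\<lambda>x. v k x + v n x))\<^sup>2 - Re (c k) - Re (c n)"
      unfolding hnorm_scale[OF add_in[OF v_in[of k] v_in[of n]], of "1/2"]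
      by (simp add: power_mult_distrib power_divide add_divide_distrib)
    then show ?thesis
      using Jn[of k] Jn[of n]
      unfolding hnorm_sq_add[OF v_in v_in] hnorm_sq_diff[OF v_in v_in] by argo
  qed
  have "\<exists>N. \<forall>k\<ge>N. \<forall>n\<ge>N. hnorm S (\<lambda>x. v k x - v n x) < e" if e: "e > 0" for e
  proof -
    obtain N where N: "4 / e\<^sup>2 < real N" using reals_Archimedean2 by blast
    have "hnorm S (\<lambda>x. v k x - v n x) < e" if "k \<ge> N" "n \<ge> N" for k n
    proof -
      have N0: "real N > 0"
        using N by (rule le_less_trans[rotated]) simp
      have "1 / real (Suc j) < e\<^sup>2 / 4" if "j \<ge> N" for j
      proof -
        have "1 / real (Suc j) \<le> 1 / real N"
          using that N0 by (intro divide_left_mono) auto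
        also have "\<dots> < e\<^sup>2 / 4" using N e N0 by (simp add: field_simps)
        finally show ?thesis .
      qed
      from this[OF \<open>k \<ge> N\<close>] this[OF \<open>n \<ge> N\<close>]
      have "(hnorm S (\<lambda>x. v k x - v n x))\<^sup>2 < e\<^sup>2"
        using gap[of k n] by argo
      then show ?thesis using e by (simp add: power_less_imp_less_base)
    qed
    then show ?thesis by blast
  qed
  then obtain u where u: "u \<in> elems S" and lim: "(\<lambda>n. hnorm S (\<lambda>x. v n x - u x)) \<longlonglongrightarrow> 0"
    using complete v_in unfolding complete_fun_space_def by blast
  have rep: "ip S w u = d" if wd: "(w, d) \<in> P" for w d
  proof -
    have w: "w \<in> elems S" using elem[OF wd] .
    define K where "K = 1 + (hnorm S w)\<^sup>2"
    have K: "K > 0" unfolding K_def by (simp add: add_pos_nonneg)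
    \<comment> \<open>Moving \<open>v n\<close> in the direction \<open>w\<close> lowers \<open>J\<close> by at least \<open>|\<delta>|\<^sup>2 / K\<close>, but \<open>v n\<close> is minimal up to \<open>1 / Suc n\<close>.\<close>
    have "(cmod (ip S w (v n) - d))\<^sup>2 \<le> K * (1 / real (Suc n))" for n
    proof -
      define \<delta> where "\<delta> = ip S w (v n) - d"
      define t where "t = - (cnj \<delta> / of_real K)"
      have "(\<lambda>x. v n x + t * w x, c n + t * d) \<in> P"
        by (intro scale add vc wd)
      from Jge[OF this]
      have "m \<le> (hnorm S (v n))\<^sup>2 + 2 * Re (ip S (v n) (\<lambda>x. t * w x)) + (hnorm S (\<lambda>x. t * w x))\<^sup>2
          - 2 * Re (c n) - 2 * Re (t * d)"
        using hnorm_sq_add[OF v_in[of n] scale_in[OF w, of t]] by simp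
      also have "ip S (v n) (\<lambda>x. t * w x) = cnj (t * ip S w (v n))"
        using ip_commute[OF v_in w] w by (simp add: ip_scale_right)
      finally have "- (1 / real (Suc n)) < 2 * Re (t * \<delta>) + (cmod t * hnorm S w)\<^sup>2"
        using Jn[of n] w unfolding \<delta>_def by (simp add: hnorm_scale right_diff_distrib)
      moreover have "t * \<delta> = of_real (- ((cmod \<delta>)\<^sup>2 / K))"
        by (simp add: t_def complex_norm_square[symmetric] mult.commute[of _ \<delta>])
      moreover have "(cmod t * hnorm S w)\<^sup>2 \<le> (cmod \<delta>)\<^sup>2 / K"
      proof -
        have "(cmod t * hnorm S w)\<^sup>2 = (cmod \<delta>)\<^sup>2 / K * ((hnorm S w)\<^sup>2 / K)"
          using K by (simp add: t_def norm_divide power_mult_distrib power_divide power2_eq_square)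
        also have "\<dots> \<le> (cmod \<delta>)\<^sup>2 / K * 1"
          using K by (intro mult_left_mono) (auto simp: K_def)
        finally show ?thesis by simp
      qed
      ultimately have "(cmod \<delta>)\<^sup>2 / K \<le> 1 / real (Suc n)" by simp
      then show ?thesis using K by (simp add: \<delta>_def field_simps)
    qed
    then have "eventually (\<lambda>n. norm ((cmod (ip S w (v n) - d))\<^sup>2) \<le> K * (1 / real (Suc n))) sequentially"
      by simp
    moreover have "(\<lambda>n. K * (1 / real (Suc n))) \<longlonglongrightarrow> 0"
      using tendsto_mult_left[OF LIMSEQ_inverse_real_of_nat, of K] by (simp add: inverse_eq_divide)
    ultimately have "(\<lambda>n. (cmod (ip S w (v n) - d))\<^sup>2) \<longlonglongrightarrow> 0"
      by (rule Lim_null_comparison)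
    moreover have "(\<lambda>n. (cmod (ip S w (v n) - d))\<^sup>2) \<longlonglongrightarrow> (cmod (ip S w u - d))\<^sup>2"
      by (intro tendsto_intros ip_tendsto_right lim v_in u w)
    ultimately have "(cmod (ip S w u - d))\<^sup>2 = 0" by (rule LIMSEQ_unique[symmetric])
    then show ?thesis by simp
  qed
  have "hnorm S u \<le> C"
  proof -
    have "cmod (ip S (v n) u) \<le> C * hnorm S (v n)" for n
      using bound[OF vc[of n]] rep[OF vc[of n]] by simp
    moreover have "(\<lambda>n. cmod (ip S (v n) u)) \<longlonglongrightarrow> cmod (ip S u u)"
      by (intro tendsto_intros ip_tendsto_left lim v_in u)
    moreover have "(\<lambda>n. C * hnorm S (v n)) \<longlonglongrightarrow> C * hnorm S u"
      by (intro tendsto_intros hnorm_tendsto lim v_in u)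
    ultimately have "cmod (ip S u u) \<le> C * hnorm S u"
      by (meson LIMSEQ_le)
    then have "hnorm S u * hnorm S u \<le> C * hnorm S u"
      by (simp add: ip_self[OF u] norm_power power2_eq_square norm_mult)
    then show ?thesis
      using C hnorm_nonneg[OF u] by (cases "hnorm S u = 0") auto
  qed
  moreover have "\<exists>w d. (w, d) \<in> P \<and> hnorm S (\<lambda>x. u x - w x) < e" if "e > 0" for e
  proof -
    have "eventually (\<lambda>n. hnorm S (\<lambda>x. v n x - u x) < e) sequentially"
      using order_tendstoD(2)[OF lim that] .
    then obtain n where "hnorm S (\<lambda>x. v n x - u x) < e"
      by (auto simp: eventually_sequentially)
    then show ?thesis
      using vc[of n] hnorm_diff_commute[OF u v_in, of n] by auto
  qed
  ultimately show thesis using that u rep by blast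
qed

end

section \<open>Square-summable families\<close>

definition ell2 :: "'i fun_space" where
  "ell2 = \<lparr> points = UNIV,
            elems = {c. (\<lambda>i. (cmod (c i))\<^sup>2) summable_on UNIV},
            ip = (\<lambda>c d. \<Sum>\<^sub>\<infinity>i. c i * cnj (d i)) \<rparr>"

lemma ell2_iff: "c \<in> elems ell2 \<longleftrightarrow> (\<lambda>i. (cmod (c i))\<^sup>2) summable_on UNIV"
  by (simp add: ell2_def)

lemma ell2_ip: "ip ell2 c d = (\<Sum>\<^sub>\<infinity>i. c i * cnj (d i))"
  by (simp add: ell2_def)

lemma ell2_product_summable:
  assumes "c \<in> elems ell2" "d \<in> elems ell2"
  shows "(\<lambda>i. c i * cnj (d i)) summable_on UNIV"
proof -
  have "(\<lambda>i. norm (c i * cnj (d i))) summable_on UNIV"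
  proof (rule summable_on_comparison_test)
    show "(\<lambda>i. (cmod (c i))\<^sup>2 + (cmod (d i))\<^sup>2) summable_on UNIV"
      using assms by (intro summable_on_add) (simp_all add: ell2_iff)
    show "norm (c i * cnj (d i)) \<le> (cmod (c i))\<^sup>2 + (cmod (d i))\<^sup>2" for i
      using sum_squares_bound[of "cmod (c i)" "cmod (d i)"]
        mult_nonneg_nonneg[OF norm_ge_zero[of "c i"] norm_ge_zero[of "d i"]]
      unfolding norm_mult complex_mod_cnj by linarith
  qed simp
  then show ?thesis by (rule abs_summable_summable)
qed

lemma ell2_add:
  assumes "c \<in> elems ell2" "d \<in> elems ell2"
  shows "(\<lambda>i. c i + d i) \<in> elems ell2"
  unfolding ell2_iff
proof (rule summable_on_comparison_test)
  show "(\<lambda>i. 2 * (cmod (c i))\<^sup>2 + 2 * (cmod (d i))\<^sup>2) summable_on UNIV"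
    using assms by (intro summable_on_add summable_on_cmult_right) (simp_all add: ell2_iff)
  show "(cmod (c i + d i))\<^sup>2 \<le> 2 * (cmod (c i))\<^sup>2 + 2 * (cmod (d i))\<^sup>2" for i
  proof -
    have "(cmod (c i + d i))\<^sup>2 \<le> (cmod (c i) + cmod (d i))\<^sup>2"
      by (intro power_mono norm_triangle_ineq norm_ge_zero)
    also have "\<dots> \<le> 2 * (cmod (c i))\<^sup>2 + 2 * (cmod (d i))\<^sup>2"
      using sum_squares_bound[of "cmod (c i)" "cmod (d i)"] by (simp add: power2_sum)
    finally show ?thesis .
  qed
qed simp

lemma ell2_scale:
  assumes "c \<in> elems ell2"
  shows "(\<lambda>i. a * c i) \<in> elems ell2"
  using summable_on_cmult_right[of "\<lambda>i. (cmod (c i))\<^sup>2" UNIV "(cmod a)\<^sup>2"] assms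
  by (simp add: ell2_iff norm_mult power_mult_distrib)

lemma ell2_ip_self:
  assumes "c \<in> elems ell2"
  shows "ip ell2 c c = of_real (\<Sum>\<^sub>\<infinity>i. (cmod (c i))\<^sup>2)"
proof -
  have "((\<lambda>i. (cmod (c i))\<^sup>2) has_sum (\<Sum>\<^sub>\<infinity>i. (cmod (c i))\<^sup>2)) UNIV"
    using assms by (simp add: ell2_iff)
  then have "((\<lambda>i. complex_of_real ((cmod (c i))\<^sup>2)) has_sum
      complex_of_real (\<Sum>\<^sub>\<infinity>i. (cmod (c i))\<^sup>2)) UNIV"
    by (simp only: has_sum_of_real_iff)
  then show ?thesis
    unfolding ell2_ip complex_norm_square by (rule infsumI)
qed

lemma hnorm_ell2_sq:
  "c \<in> elems ell2 \<Longrightarrow> (hnorm ell2 c)\<^sup>2 = (\<Sum>\<^sub>\<infinity>i. (cmod (c i))\<^sup>2)"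
  by (simp add: hnorm_def ell2_ip_self infsum_nonneg)

lemma sum_le_hnorm_ell2_sq:
  assumes "c \<in> elems ell2" "finite F"
  shows "(\<Sum>i\<in>F. (cmod (c i))\<^sup>2) \<le> (hnorm ell2 c)\<^sup>2"
  using assms unfolding hnorm_ell2_sq[OF assms(1)]
  by (intro finite_sum_le_infsum) (simp_all add: ell2_iff)

lemma inner_fun_space_ell2: "inner_fun_space ell2"
  unfolding inner_fun_space_def
proof (intro conjI ballI allI impI)
  fix c d u :: "'a \<Rightarrow> complex" and a :: complex
  show "zext (points ell2) c = c" by (simp add: zext_def ell2_def)
  show "(\<lambda>i::'a. 0) \<in> elems ell2" by (simp add: ell2_iff)
  assume c: "c \<in> elems ell2"
  show "(\<lambda>i. a * c i) \<in> elems ell2" using c by (rule ell2_scale)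
  show "0 \<le> Re (ip ell2 c c)" by (simp add: ell2_ip_self[OF c] infsum_nonneg)
  show "c = (\<lambda>i. 0)" if "ip ell2 c c = 0"
  proof
    fix i
    have "(\<Sum>\<^sub>\<infinity>i. (cmod (c i))\<^sup>2) = 0" using that by (simp add: ell2_ip_self[OF c])
    then have "(cmod (c i))\<^sup>2 = 0"
      using sum_le_hnorm_ell2_sq[OF c, of "{i}"] by (simp add: hnorm_ell2_sq[OF c])
    then show "c i = 0" by simp
  qed
  assume d: "d \<in> elems ell2"
  show "(\<lambda>i. c i + d i) \<in> elems ell2" using c d by (rule ell2_add)
  show "ip ell2 (\<lambda>i. a * c i) d = a * ip ell2 c d"
    unfolding ell2_ip using ell2_product_summable[OF c d]
    by (simp add: mult.assoc infsum_cmult_right)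
  show "ip ell2 d c = cnj (ip ell2 c d)"
    unfolding ell2_ip infsum_cnj[symmetric] by (simp add: mult.commute)
  assume u: "u \<in> elems ell2"
  show "ip ell2 (\<lambda>i. c i + d i) u = ip ell2 c u + ip ell2 d u"
    unfolding ell2_ip using ell2_product_summable[OF c u] ell2_product_summable[OF d u]
    by (simp add: distrib_right infsum_add)
qed

interpretation ell2: inner_space ell2
  by standard (rule inner_fun_space_ell2)

lemma complete_ell2: "complete_fun_space ell2"
  unfolding complete_fun_space_def
proof (intro allI impI)
  fix s :: "nat \<Rightarrow> 'i \<Rightarrow> complex"
  assume s: "\<forall>n. s n \<in> elems ell2"
    and cauchy: "\<forall>e>0. \<exists>N. \<forall>m\<ge>N. \<forall>n\<ge>N. hnorm ell2 (\<lambda>x. s m x - s n x) < e"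
  have sd: "(\<lambda>x. s m x - s n x) \<in> elems ell2" for m n
    using s by (simp add: ell2.diff_in)
  have coord: "cmod (c i) \<le> hnorm ell2 c" if "c \<in> elems ell2" for c and i :: 'i
    by (rule power2_le_imp_le)
      (use sum_le_hnorm_ell2_sq[OF that, of "{i}"] ell2.hnorm_nonneg[OF that] in simp_all)
  have "convergent (\<lambda>n. s n i)" for i
  proof (rule Cauchy_convergent, rule metric_CauchyI)
    fix e :: real assume "e > 0"
    then obtain N where "\<forall>m\<ge>N. \<forall>n\<ge>N. hnorm ell2 (\<lambda>x. s m x - s n x) < e"
      using cauchy by blast
    then show "\<exists>N. \<forall>m\<ge>N. \<forall>n\<ge>N. dist (s m i) (s n i) < e"
      using coord[OF sd, where i = i] unfolding dist_norm by (meson le_less_trans)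
  qed
  then obtain h where h: "\<And>i. (\<lambda>n. s n i) \<longlonglongrightarrow> h i"
    unfolding convergent_def by metis
  have close: "(\<lambda>i. s n i - h i) \<in> elems ell2 \<and> hnorm ell2 (\<lambda>i. s n i - h i) \<le> e"
    if e: "e > 0" and N: "\<forall>m\<ge>N. \<forall>n\<ge>N. hnorm ell2 (\<lambda>x. s m x - s n x) < e" and n: "n \<ge> N"
    for e N n
  proof -
    \<comment> \<open>Only coordinatewise convergence is known so far, so the limit is taken in finite partial sums.\<close>
    have fin: "(\<Sum>i\<in>F. (cmod (s n i - h i))\<^sup>2) \<le> e\<^sup>2" if F: "finite F" for F
    proof (rule LIMSEQ_le_const2)
      show "(\<lambda>m. \<Sum>i\<in>F. (cmod (s n i - s m i))\<^sup>2) \<longlonglongrightarrow> (\<Sum>i\<in>F. (cmod (s n i - h i))\<^sup>2)"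
        by (intro tendsto_intros h)
      show "\<exists>M. \<forall>m\<ge>M. (\<Sum>i\<in>F. (cmod (s n i - s m i))\<^sup>2) \<le> e\<^sup>2"
      proof (intro exI allI impI)
        fix m assume "m \<ge> N"
        then have "hnorm ell2 (\<lambda>x. s n x - s m x) \<le> e" using N n by (simp add: less_imp_le)
        then have "(hnorm ell2 (\<lambda>x. s n x - s m x))\<^sup>2 \<le> e\<^sup>2"
          using ell2.hnorm_nonneg[OF sd] by (intro power_mono)
        then show "(\<Sum>i\<in>F. (cmod (s n i - s m i))\<^sup>2) \<le> e\<^sup>2"
          using sum_le_hnorm_ell2_sq[OF sd[of n m] F] by linarith
      qed
    qed
    then have summ: "(\<lambda>i. (cmod (s n i - h i))\<^sup>2) summable_on UNIV"
      by (intro nonneg_bdd_above_summable_on bdd_aboveI2) auto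
    then have "(hnorm ell2 (\<lambda>i. s n i - h i))\<^sup>2 \<le> e\<^sup>2"
      using fin by (subst hnorm_ell2_sq) (auto simp: ell2_iff intro: infsum_le_finite_sums)
    then have "hnorm ell2 (\<lambda>i. s n i - h i) \<le> e"
      by (rule power2_le_imp_le) (use e in simp)
    then show ?thesis using summ by (simp add: ell2_iff)
  qed
  obtain N1 where "\<forall>m\<ge>N1. \<forall>n\<ge>N1. hnorm ell2 (\<lambda>x. s m x - s n x) < 1"
    using cauchy zero_less_one by blast
  from close[OF zero_less_one this order_refl] have "(\<lambda>i. s N1 i - h i) \<in> elems ell2" ..
  then have "(\<lambda>i. s N1 i - (s N1 i - h i)) \<in> elems ell2"
    by (rule ell2.diff_in[OF spec[OF s]])
  moreover have "(\<lambda>i. s N1 i - (s N1 i - h i)) = h" by (simp add: fun_eq_iff)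
  ultimately have hin: "h \<in> elems ell2" by (simp only:)
  have "(\<lambda>n. hnorm ell2 (\<lambda>x. s n x - h x)) \<longlonglongrightarrow> 0"
  proof (rule LIMSEQ_I)
    fix r :: real assume r: "r > 0"
    then have "r / 2 > 0" by simp
    then obtain N where N: "\<forall>m\<ge>N. \<forall>n\<ge>N. hnorm ell2 (\<lambda>x. s m x - s n x) < r / 2"
      using cauchy by blast
    have "norm (hnorm ell2 (\<lambda>x. s n x - h x) - 0) < r" if "n \<ge> N" for n
      using close[OF \<open>r / 2 > 0\<close> N that] ell2.hnorm_nonneg[OF conjunct1[OF close[OF \<open>r / 2 > 0\<close> N that]]] r
      by simp
    then show "\<exists>N. \<forall>n\<ge>N. norm (hnorm ell2 (\<lambda>x. s n x - h x) - 0) < r" by blast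
  qed
  then show "\<exists>h\<in>elems ell2. (\<lambda>n. hnorm ell2 (\<lambda>x. s n x - h x)) \<longlonglongrightarrow> 0"
    using hin by blast
qed

section \<open>The kernel of a feature map\<close>

context complete_inner_space
begin

text \<open>
  The space consists of the functions \<open>x \<mapsto> \<langle>v, \<Phi> x\<rangle>\<close>. Different vectors \<open>v\<close> can give the same
  function; taking \<open>v\<close> from the double orthogonal complement \<open>L\<close> of the range of \<open>\<Phi>\<close> makes the
  correspondence bijective, and \<open>L\<close> is visibly closed, so that completeness is inherited without
  any decomposition of the ambient space.
\<close>

lemma rkhs_of_feature_map:
  fixes \<Phi> :: "'b \<Rightarrow> 'a \<Rightarrow> complex"
  assumes \<Phi>: "\<And>x. x \<in> X \<Longrightarrow> \<Phi> x \<in> elems S"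
    and k: "\<And>w z. w \<in> X \<Longrightarrow> z \<in> X \<Longrightarrow> k w z = ip S (\<Phi> w) (\<Phi> z)"
  shows "\<exists>T. is_rkhs X k T"
proof -
  define L where
    "L = {v \<in> elems S. \<forall>u\<in>elems S. (\<forall>x\<in>X. ip S u (\<Phi> x) = 0) \<longrightarrow> ip S v u = 0}"
  define R where "R = (\<lambda>v. zext X (\<lambda>x. ip S v (\<Phi> x)))"
  define lift where "lift = the_inv_into L R"
  define T where "T = \<lparr> points = X, elems = R ` L, ip = (\<lambda>g h. ip S (lift g) (lift h)) \<rparr>"
  have LS: "v \<in> elems S" if "v \<in> L" for v using that by (simp add: L_def)
  have L0: "(\<lambda>x. 0) \<in> L" by (simp add: L_def)
  have Ladd: "(\<lambda>x. v x + w x) \<in> L" if "v \<in> L" "w \<in> L" for v w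
    using that by (simp add: L_def ip_add_left add_in)
  have Lscale: "(\<lambda>x. c * v x) \<in> L" if "v \<in> L" for c v
    using that by (simp add: L_def ip_scale_left scale_in)
  have Ldiff: "(\<lambda>x. v x - w x) \<in> L" if "v \<in> L" "w \<in> L" for v w
    using that by (simp add: L_def ip_diff_left diff_in)
  have Radd: "R (\<lambda>x. v x + w x) = (\<lambda>x. R v x + R w x)" if "v \<in> L" "w \<in> L" for v w
    using that by (auto simp: R_def zext_def fun_eq_iff ip_add_left LS \<Phi>)
  have Rdiff: "R (\<lambda>x. v x - w x) = (\<lambda>x. R v x - R w x)" if "v \<in> L" "w \<in> L" for v w
    using that by (auto simp: R_def zext_def fun_eq_iff ip_diff_left LS \<Phi>)
  have Rscale: "R (\<lambda>x. c * v x) = (\<lambda>x. c * R v x)" if "v \<in> L" for c v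
    using that by (auto simp: R_def zext_def fun_eq_iff ip_scale_left LS \<Phi>)
  have R0: "R (\<lambda>x. 0) = (\<lambda>x. 0)"
    by (auto simp: R_def zext_def fun_eq_iff \<Phi>)
  have ker: "v = (\<lambda>x. 0)" if v: "v \<in> L" and Rv: "R v = (\<lambda>x. 0)" for v
  proof -
    have "ip S v (\<Phi> x) = 0" if "x \<in> X" for x
      using fun_cong[OF Rv, of x] that by (simp add: R_def zext_def)
    then have "ip S v v = 0" using v by (auto simp: L_def)
    then show ?thesis
      using hnorm_eq_0[OF LS[OF v]] by (simp add: hnorm_def)
  qed
  have inj: "inj_on R L"
  proof (rule inj_onI)
    fix v w assume vw: "v \<in> L" "w \<in> L" "R v = R w"
    then have "(\<lambda>x. v x - w x) = (\<lambda>x. 0)"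
      by (intro ker Ldiff) (simp_all add: Rdiff)
    then show "v = w" by (auto simp: fun_eq_iff)
  qed
  have liftR: "lift (R v) = v" if "v \<in> L" for v
    unfolding lift_def by (rule the_inv_into_f_f[OF inj that])
  have ipT: "ip T (R v) (R w) = ip S v w" if "v \<in> L" "w \<in> L" for v w
    using that by (simp add: T_def liftR)
  have pT: "points T = X" and eT: "elems T = R ` L" by (simp_all add: T_def)
  have hT: "hnorm T (R v) = hnorm S v" if "v \<in> L" for v
    using that by (simp add: hnorm_def ipT)
  have inner_T: "inner_fun_space T"
    unfolding inner_fun_space_def eT pT ball_simps
  proof (intro conjI ballI allI impI)
    fix v w u and c :: complex
    show "(\<lambda>x. 0) \<in> R ` L" using L0 R0 by (metis imageI)
    assume v: "v \<in> L"
    show "zext X (R v) = R v" by (auto simp: R_def zext_def)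
    show "(\<lambda>x. c * R v x) \<in> R ` L" using Rscale[OF v] Lscale[OF v] by (metis imageI)
    show "0 \<le> Re (ip T (R v) (R v))" using v by (simp add: ipT ip_self LS)
    show "R v = (\<lambda>x. 0)" if "ip T (R v) (R v) = 0"
      using that v R0 hnorm_eq_0[OF LS[OF v]] by (simp add: ipT hnorm_def)
    assume w: "w \<in> L"
    show "(\<lambda>x. R v x + R w x) \<in> R ` L" using Radd[OF v w] Ladd[OF v w] by (metis imageI)
    show "ip T (\<lambda>x. c * R v x) (R w) = c * ip T (R v) (R w)"
      unfolding Rscale[OF v, symmetric]
      using v w by (simp add: ipT Lscale ip_scale_left LS)
    show "ip T (R w) (R v) = cnj (ip T (R v) (R w))"
      using ip_commute[OF LS[OF w] LS[OF v]] v w by (simp add: ipT)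
    assume u: "u \<in> L"
    show "ip T (\<lambda>x. R v x + R w x) (R u) = ip T (R v) (R u) + ip T (R w) (R u)"
      unfolding Radd[OF v w, symmetric]
      using v w u by (simp add: ipT Ladd ip_add_left LS)
  qed
  have complete_T: "complete_fun_space T"
    unfolding complete_fun_space_def eT
  proof (intro allI impI)
    fix s :: "nat \<Rightarrow> 'b \<Rightarrow> complex"
    assume s: "\<forall>n. s n \<in> R ` L"
      and cauchy: "\<forall>e>0. \<exists>N. \<forall>m\<ge>N. \<forall>n\<ge>N. hnorm T (\<lambda>x. s m x - s n x) < e"
    from s obtain v where v: "\<And>n. v n \<in> L" and sv: "\<And>n. s n = R (v n)"
    proof -
      have "\<exists>v. \<forall>n. v n \<in> L \<and> s n = R (v n)"
        by (intro choice) (use s in blast)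
      then show ?thesis using that by blast
    qed
    have vS: "v n \<in> elems S" for n using v by (rule LS)
    have "hnorm T (\<lambda>x. s m x - s n x) = hnorm S (\<lambda>x. v m x - v n x)" for m n
      using hT[OF Ldiff[OF v[of m] v[of n]]] Rdiff[OF v[of m] v[of n]] by (simp add: sv)
    then have "\<forall>e>0. \<exists>N. \<forall>m\<ge>N. \<forall>n\<ge>N. hnorm S (\<lambda>x. v m x - v n x) < e"
      using cauchy by simp
    then obtain u where u: "u \<in> elems S" and lim: "(\<lambda>n. hnorm S (\<lambda>x. v n x - u x)) \<longlonglongrightarrow> 0"
      using complete vS unfolding complete_fun_space_def by blast
    have "ip S u w = 0" if w: "w \<in> elems S" and wX: "\<forall>x\<in>X. ip S w (\<Phi> x) = 0" for w
    proof -
      have "ip S (v n) w = 0" for n using v[of n] w wX by (simp add: L_def)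
      then show ?thesis
        using ip_tendsto_left[OF vS u w lim] by (simp add: LIMSEQ_const_iff)
    qed
    then have uL: "u \<in> L" using u by (simp add: L_def)
    have "hnorm T (\<lambda>x. s n x - R u x) = hnorm S (\<lambda>x. v n x - u x)" for n
      using hT[OF Ldiff[OF v[of n] uL]] Rdiff[OF v[of n] uL] by (simp add: sv)
    then show "\<exists>h\<in>R ` L. (\<lambda>n. hnorm T (\<lambda>x. s n x - h x)) \<longlonglongrightarrow> 0"
      using uL lim by (intro bexI[of _ "R u"]) auto
  qed
  have "zext X (k w) \<in> elems T \<and> (\<forall>h\<in>elems T. ip T h (zext X (k w)) = h w)" if w: "w \<in> X" for w
  proof -
    have "ip S (\<Phi> w) u = 0" if "u \<in> elems S" "\<forall>x\<in>X. ip S u (\<Phi> x) = 0" for u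
      using that w ip_commute[OF \<Phi>[OF w] that(1)] by simp
    then have \<Phi>L: "\<Phi> w \<in> L" using \<Phi>[OF w] by (simp add: L_def)
    have kw: "zext X (k w) = R (\<Phi> w)"
      by (auto simp: R_def zext_def k w)
    have "ip T (R v) (R (\<Phi> w)) = R v w" if "v \<in> L" for v
      unfolding ipT[OF that \<Phi>L] using w by (simp add: R_def zext_def)
    then show ?thesis unfolding kw eT
      using \<Phi>L by blast
  qed
  then have "is_rkhs X k T"
    unfolding is_rkhs_def using pT inner_T complete_T by blast
  then show ?thesis ..
qed

end

section \<open>Existence of the Drury-Arveson space\<close>

lemma Re_herm: "Re (herm z w) = z \<bullet> w"
  by (simp add: herm_def inner_vec_def inner_complex_def)

lemma herm_self: "herm z z = of_real ((norm z)\<^sup>2)"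
  by (simp add: complex_eq_iff Re_herm power2_norm_eq_inner) (simp add: herm_def)

lemma herm_commute: "herm w z = cnj (herm z w)"
  by (simp add: herm_def mult.commute)

lemma norm_herm_le: "cmod (herm z w) \<le> norm z * norm w"
proof -
  have "cmod (herm z w) \<le> (\<Sum>j\<in>UNIV. \<bar>cmod (z $ j)\<bar> * \<bar>cmod (w $ j)\<bar>)"
    unfolding herm_def by (rule order.trans[OF norm_sum]) (simp add: norm_mult)
  also have "\<dots> \<le> norm z * norm w"
    unfolding norm_vec_def by (rule L2_set_mult_ineq)
  finally show ?thesis .
qed

lemma norm_herm_less_1:
  assumes "norm z < 1" "norm w \<le> 1"
  shows "cmod (herm z w) < 1"
proof -
  have "norm z * norm w \<le> norm z * 1" using assms by (intro mult_left_mono) auto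
  then show ?thesis using norm_herm_le[of z w] assms by linarith
qed

lemma has_sum_finite_sum:
  fixes F :: "'j \<Rightarrow> 'i \<Rightarrow> 'b::topological_comm_monoid_add"
  assumes "finite J" "\<And>j. j \<in> J \<Longrightarrow> (F j has_sum s j) A"
  shows "((\<lambda>i. \<Sum>j\<in>J. F j i) has_sum (\<Sum>j\<in>J. s j)) A"
  using assms by (induction J rule: finite_induct) (auto intro: has_sum_add)

text \<open>
  Every word is empty or has a first letter. For the geometric series this gives the equation
  \<open>p = 1 + (\<Sum>j. t j) p\<close>; for square-summable families it says that removing first letters
  loses only the norm of the coefficient at the empty word.
\<close>

lemma has_sum_words_Cons:
  fixes F :: "'d::finite list \<Rightarrow> 'b::topological_comm_monoid_add"
  assumes "\<And>j. ((\<lambda>w. F (j # w)) has_sum s j) UNIV"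
  shows "(F has_sum (F [] + (\<Sum>j\<in>UNIV. s j))) UNIV"
proof -
  have "(F has_sum s j) (range ((#) j))" for j
    using assms[of j] by (subst has_sum_reindex) (auto simp: inj_on_def o_def)
  then have "(F has_sum (\<Sum>j\<in>UNIV. s j)) (\<Union>j. range ((#) j))"
    by (intro sum_has_sum) auto
  then have "(F has_sum (F [] + (\<Sum>j\<in>UNIV. s j))) ({[]} \<union> (\<Union>j. range ((#) j)))"
    by (intro has_sum_Un_disjoint) (auto intro!: has_sum_finiteI[of "{[]}"])
  also have "{[]} \<union> (\<Union>j. range ((#) j)) = UNIV"
    by (auto simp: image_iff) (metis list.exhaust)
  finally show ?thesis .
qed

lemma summable_on_words_Cons:
  fixes F :: "'d::finite list \<Rightarrow> 'b::banach"
  assumes "F summable_on UNIV"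
  shows "(\<lambda>w. F (j # w)) summable_on UNIV"
proof -
  have "F summable_on range ((#) j)"
    using assms by (rule summable_on_subset_banach) simp
  then show ?thesis by (subst (asm) summable_on_reindex) (auto simp: inj_on_def o_def)
qed

lemma summable_on_words_real:
  fixes r :: "'d::finite \<Rightarrow> real"
  assumes r: "\<And>j. r j \<ge> 0" and s1: "(\<Sum>j\<in>UNIV. r j) < 1"
  shows "(\<lambda>w. \<Prod>j\<leftarrow>w. r j) summable_on UNIV"
proof -
  define s where "s = (\<Sum>j\<in>UNIV. r j)"
  have s0: "s \<ge> 0" unfolding s_def using r by (intro sum_nonneg)
  have nonneg: "(\<Prod>j\<leftarrow>w. r j) \<ge> 0" for w
    using r by (induction w) auto
  have fin: "finite {w :: 'd list. length w \<le> n}" for n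
    using finite_lists_length_le[of "UNIV :: 'd set" n] by simp
  have bound: "(\<Sum>w | length w \<le> n. \<Prod>j\<leftarrow>w. r j) \<le> 1 / (1 - s)" for n
  proof (induction n)
    case 0
    show ?case using s0 s1 by (simp add: s_def)
  next
    case (Suc n)
    \<comment> \<open>The partial sums \<open>S n\<close> over words of length at most \<open>n\<close> satisfy \<open>S (n + 1) = 1 + s S n\<close>, and \<open>1 / (1 - s)\<close> is the fixed point.\<close>
    have split: "{w :: 'd list. length w \<le> Suc n} =
        insert [] ((\<lambda>(j, w). j # w) ` (UNIV \<times> {w. length w \<le> n}))"
      by (auto simp: image_iff) (metis Suc_le_mono length_Cons list.exhaust)
    have "(\<Sum>w | length w \<le> Suc n. \<Prod>j\<leftarrow>w. r j) =
        1 + (\<Sum>p \<in> UNIV \<times> {w. length w \<le> n}. r (fst p) * (\<Prod>j\<leftarrow>snd p. r j))"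
      unfolding split
      by (subst sum.insert, use fin in force, force, subst sum.reindex)
        (auto simp: inj_on_def split_beta)
    also have "\<dots> = 1 + s * (\<Sum>w | length w \<le> n. \<Prod>j\<leftarrow>w. r j)"
      unfolding s_def sum_product sum.cartesian_product by (simp add: split_beta)
    also have "\<dots> \<le> 1 + s * (1 / (1 - s))"
      using Suc s0 by (intro add_left_mono mult_left_mono)
    also have "\<dots> = 1 / (1 - s)" using s1 by (simp add: s_def field_simps)
    finally show ?case .
  qed
  show ?thesis
  proof (intro nonneg_bdd_above_summable_on bdd_aboveI2)
    show "(\<Sum>w\<in>F. \<Prod>j\<leftarrow>w. r j) \<le> 1 / (1 - s)" if "F \<in> {F. F \<subseteq> UNIV \<and> finite F}" for F
    proof -
      have F: "finite F" using that by simp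
      define n where "n = Max (insert 0 (length ` F))"
      have "F \<subseteq> {w. length w \<le> n}"
        using F by (auto simp: n_def intro!: Max_ge)
      then have "(\<Sum>w\<in>F. \<Prod>j\<leftarrow>w. r j) \<le> (\<Sum>w | length w \<le> n. \<Prod>j\<leftarrow>w. r j)"
        using fin nonneg by (intro sum_mono2) auto
      then show ?thesis using bound[of n] by linarith
    qed
  qed (rule nonneg)
qed

lemma has_sum_words_geometric:
  fixes t :: "'d::finite \<Rightarrow> complex"
  assumes "(\<Sum>j\<in>UNIV. cmod (t j)) < 1"
  shows "((\<lambda>w. \<Prod>j\<leftarrow>w. t j) has_sum (1 / (1 - (\<Sum>j\<in>UNIV. t j)))) UNIV"
proof -
  have "(\<lambda>w. \<Prod>j\<leftarrow>w. cmod (t j)) summable_on UNIV"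
    using assms by (intro summable_on_words_real) auto
  moreover have "(\<Prod>j\<leftarrow>w. cmod (t j)) = norm (\<Prod>j\<leftarrow>w. t j)" for w
    by (induction w) (simp_all add: norm_mult)
  ultimately have "(\<lambda>w. \<Prod>j\<leftarrow>w. t j) summable_on UNIV"
    by (simp add: abs_summable_summable)
  then obtain p where p: "((\<lambda>w. \<Prod>j\<leftarrow>w. t j) has_sum p) UNIV"
    by (auto simp: summable_on_def)
  have "((\<lambda>w. \<Prod>j\<leftarrow>w. t j) has_sum ((\<Prod>j\<leftarrow>[]. t j) + (\<Sum>j\<in>UNIV. t j * p))) UNIV"
    by (rule has_sum_words_Cons) (use has_sum_cmult_right[OF p] in simp)
  from has_sum_unique[OF this p] have "1 + (\<Sum>j\<in>UNIV. t j) * p = p"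
    by (simp add: sum_distrib_right)
  moreover have "(\<Sum>j\<in>UNIV. t j) \<noteq> 1"
    using assms norm_sum[of t UNIV] by force
  ultimately have "p = 1 / (1 - (\<Sum>j\<in>UNIV. t j))"
    by (simp add: field_simps) 
  then show ?thesis using p by simp
qed

text \<open>
  The vector of all noncommutative monomials in \<open>cnj z\<close>, indexed by words. Words in place of
  multi-indices turn the power \<open>\<langle>z, w\<rangle>\<^sup>n\<close> into a sum over words of length \<open>n\<close> without
  multinomial coefficients.
\<close>

definition fock_vector :: "complex ^ 'd \<Rightarrow> 'd list \<Rightarrow> complex" where
  "fock_vector z w = (\<Prod>j\<leftarrow>w. cnj (z $ j))"

lemma fock_vector_in_ell2:
  fixes z :: "complex ^ 'd"
  assumes "norm z < 1"
  shows "fock_vector z \<in> elems ell2"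
proof -
  have "(\<Sum>j\<in>UNIV. (cmod (z $ j))\<^sup>2) < 1"
    using assms by (simp add: norm_vec_def L2_set_def)
  then have "(\<lambda>w. \<Prod>j\<leftarrow>w. (cmod (z $ j))\<^sup>2) summable_on UNIV"
    by (intro summable_on_words_real) auto
  moreover have "(\<Prod>j\<leftarrow>w. (cmod (z $ j))\<^sup>2) = (cmod (fock_vector z w))\<^sup>2" for w
    unfolding fock_vector_def by (induction w) (simp_all add: norm_mult power_mult_distrib)
  ultimately show ?thesis by (simp add: ell2_iff)
qed

lemma ip_fock_vector:
  fixes z w :: "complex ^ 'd"
  assumes "norm z < 1" "norm w < 1"
  shows "ip ell2 (fock_vector w) (fock_vector z) = da_kernel w z"
proof -
  have "(\<Sum>j\<in>UNIV. cmod (z $ j * cnj (w $ j))) = (\<Sum>j\<in>UNIV. \<bar>cmod (z $ j)\<bar> * \<bar>cmod (w $ j)\<bar>)"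
    by (simp add: norm_mult)
  also have "\<dots> \<le> norm z * norm w"
    unfolding norm_vec_def by (rule L2_set_mult_ineq)
  also have "\<dots> < 1"
    using assms mult_le_one[of "norm z" "norm w"] mult_left_mono[of "norm w" 1 "norm z"] by simp
  finally have "((\<lambda>u. \<Prod>j\<leftarrow>u. z $ j * cnj (w $ j)) has_sum da_kernel w z) UNIV"
    unfolding da_kernel_def herm_def by (rule has_sum_words_geometric)
  moreover have "(\<Prod>j\<leftarrow>u. z $ j * cnj (w $ j)) = fock_vector w u * cnj (fock_vector z u)" for u
    unfolding fock_vector_def by (induction u) simp_all
  ultimately show ?thesis
    unfolding ell2_ip by (auto intro: infsumI)
qed

lemma is_rkhs_drury_arveson:
  "is_rkhs (ball 0 1) da_kernel (drury_arveson :: (complex ^ 'd::finite) fun_space)"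
proof -
  interpret complete_inner_space "ell2 :: ('d::finite) list fun_space"
    by standard (rule complete_ell2)
  have "\<exists>T. is_rkhs (ball 0 1) (da_kernel :: complex ^ 'd \<Rightarrow> _) T"
    by (rule rkhs_of_feature_map[of _ fock_vector]) (auto simp: fock_vector_in_ell2 ip_fock_vector)
  then show ?thesis
    unfolding drury_arveson_def by (rule someI_ex)
qed

section \<open>Contractive multipliers\<close>

text \<open>
  Positive definiteness of \<open>(1 - \<phi>(u) cnj \<phi>(w)) k(u, w)\<close>, the kernel of the de Branges-Rovnyak space
  of \<open>\<phi>\<close>. On linear combinations of kernel functions it says that \<open>k\<^sub>w \<mapsto> cnj \<phi>(w) k\<^sub>w\<close>, the
  adjoint of multiplication by \<open>\<phi>\<close>, is a contraction.
\<close>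

definition schur_kernel_pos ::
  "'a set \<Rightarrow> ('a \<Rightarrow> 'a \<Rightarrow> complex) \<Rightarrow> ('a \<Rightarrow> complex) \<Rightarrow> bool" where
  "schur_kernel_pos X k \<phi> \<longleftrightarrow> (\<forall>A a. finite A \<longrightarrow> A \<subseteq> X \<longrightarrow>
     0 \<le> Re (\<Sum>w\<in>A. \<Sum>u\<in>A. a w * cnj (a u) * ((1 - \<phi> u * cnj (\<phi> w)) * k w u)))"

text \<open>
  With \<open>d = 1 - cnj \<alpha> b\<close>, the new kernel is \<open>(1 - |\<alpha>|\<^sup>2) / (d(u) cnj d(w))\<close> times the old one, and
  the factors \<open>1 / d\<close> can be absorbed into the coefficients. In operator terms this
  is von Neumann's inequality for a disc automorphism.
\<close>

lemma schur_kernel_pos_moebius: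
  assumes b: "schur_kernel_pos X k b" and b1: "\<And>x. x \<in> X \<Longrightarrow> cmod (b x) < 1"
    and \<alpha>: "cmod \<alpha> < 1"
  shows "schur_kernel_pos X k (\<lambda>x. (b x - \<alpha>) / (1 - cnj \<alpha> * b x))"
  unfolding schur_kernel_pos_def
proof (intro allI impI)
  fix A a assume A: "finite A" "A \<subseteq> X"
  define d where "d = (\<lambda>x. 1 - cnj \<alpha> * b x)"
  have d0: "d x \<noteq> 0" if "x \<in> X" for x
  proof -
    have "cmod (cnj \<alpha> * b x) < 1"
      using b1[OF that] \<alpha> mult_strict_mono'[of "cmod \<alpha>" 1 "cmod (b x)" 1] by (simp add: norm_mult)
    then show ?thesis unfolding d_def by force
  qed
  define c where "c = (\<lambda>x. a x / cnj (d x))"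
  have eq: "a w * cnj (a u) * ((1 - ((b u - \<alpha>) / d u) * cnj ((b w - \<alpha>) / d w)) * k w u) =
      of_real (1 - (cmod \<alpha>)\<^sup>2) * (c w * cnj (c u) * ((1 - b u * cnj (b w)) * k w u))"
    if "w \<in> A" "u \<in> A" for w u
  proof -
    have nz: "d w \<noteq> 0" "d u \<noteq> 0" using d0 that A by auto
    have "d u * cnj (d w) - (b u - \<alpha>) * cnj (b w - \<alpha>) = (1 - \<alpha> * cnj \<alpha>) * (1 - b u * cnj (b w))"
      by (simp add: d_def algebra_simps)
    then have "1 - ((b u - \<alpha>) / d u) * cnj ((b w - \<alpha>) / d w) =
        (1 - \<alpha> * cnj \<alpha>) * (1 - b u * cnj (b w)) / (d u * cnj (d w))"
      using nz by (simp add: divide_simps)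
    moreover have "of_real (1 - (cmod \<alpha>)\<^sup>2) = 1 - \<alpha> * cnj \<alpha>"
      by (simp add: complex_norm_square[symmetric])
    ultimately show ?thesis
      by (simp add: c_def mult_ac)
  qed
  have "(\<Sum>w\<in>A. \<Sum>u\<in>A. a w * cnj (a u) * ((1 - ((b u - \<alpha>) / d u) * cnj ((b w - \<alpha>) / d w)) * k w u)) =
      of_real (1 - (cmod \<alpha>)\<^sup>2) * (\<Sum>w\<in>A. \<Sum>u\<in>A. c w * cnj (c u) * ((1 - b u * cnj (b w)) * k w u))"
    unfolding sum_distrib_left by (intro sum.cong refl eq)
  also have "Re \<dots> = (1 - (cmod \<alpha>)\<^sup>2) *
      Re (\<Sum>w\<in>A. \<Sum>u\<in>A. c w * cnj (c u) * ((1 - b u * cnj (b w)) * k w u))"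
    by (simp only: Re_complex_of_real Im_complex_of_real times_complex.sel mult_zero_left diff_zero)
  also have "\<dots> \<ge> 0"
    using b A \<alpha> unfolding schur_kernel_pos_def
    by (intro mult_nonneg_nonneg) (auto simp: abs_square_le_1)
  finally show "0 \<le> Re (\<Sum>w\<in>A. \<Sum>u\<in>A. a w * cnj (a u) *
      ((1 - (b u - \<alpha>) / (1 - cnj \<alpha> * b u) * cnj ((b w - \<alpha>) / (1 - cnj \<alpha> * b w))) * k w u))"
    unfolding d_def .
qed

text \<open>
  In the Fock space, \<open>k\<^sub>w \<mapsto> cnj \<langle>w, q\<rangle> k\<^sub>w\<close> is the restriction of the annihilation operator
  \<open>(T v) u = (\<Sum>j. q\<^sub>j v (j # u))\<close>, which is a contraction by the Cauchy-Schwarz inequality in the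
  sum over \<open>j\<close>.
\<close>

lemma schur_kernel_pos_herm:
  fixes q :: "complex ^ 'd"
  assumes q: "norm q \<le> 1"
  shows "schur_kernel_pos (ball 0 1) da_kernel (\<lambda>z. herm z q)"
  unfolding schur_kernel_pos_def
proof (intro allI impI)
  fix A :: "(complex ^ 'd) set" and a
  assume A: "finite A" "A \<subseteq> ball 0 1"
  have fock: "fock_vector w \<in> elems ell2" if "w \<in> A" for w
    using that A by (intro fock_vector_in_ell2) auto
  define comb where "comb = (\<lambda>c u. \<Sum>w\<in>A. c w * fock_vector w u)"
  have comb_in: "comb c \<in> elems ell2" for c
    unfolding comb_def[abs_def] using A fock by (intro ell2.sum_in ell2.scale_in) auto
  have comb_sq: "(hnorm ell2 (comb c))\<^sup>2 = Re (\<Sum>w\<in>A. \<Sum>u\<in>A. c w * cnj (c u) * da_kernel w u)" for c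
  proof -
    have "ip ell2 (comb c) (comb c) =
        (\<Sum>w\<in>A. \<Sum>u\<in>A. c w * (cnj (c u) * ip ell2 (fock_vector w) (fock_vector u)))"
      unfolding comb_def[abs_def] using A fock
      by (simp add: ell2.ip_sum_left ell2.ip_sum_right ell2.sum_in ell2.scale_in
          ell2.ip_scale_left ell2.ip_scale_right)
    also have "\<dots> = (\<Sum>w\<in>A. \<Sum>u\<in>A. c w * cnj (c u) * da_kernel w u)"
      using A by (intro sum.cong refl) (auto simp: ip_fock_vector subset_iff mult.assoc)
    finally show ?thesis using ell2.hnorm_sq[OF comb_in[of c]] by simp
  qed
  define a' where "a' = (\<lambda>w. a w * cnj (herm w q))"
  have shift: "comb a' u = (\<Sum>j\<in>UNIV. q $ j * comb a (j # u))" for u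
  proof -
    have "comb a' u = (\<Sum>w\<in>A. \<Sum>j\<in>UNIV. q $ j * (a w * fock_vector w (j # u)))"
      unfolding comb_def a'_def herm_def fock_vector_def
      by (intro sum.cong refl) (simp add: sum_distrib_left sum_distrib_right mult_ac)
    also have "\<dots> = (\<Sum>j\<in>UNIV. q $ j * comb a (j # u))"
      unfolding comb_def sum_distrib_left by (rule sum.swap)
    finally show ?thesis .
  qed
  have shift_le: "(cmod (comb a' u))\<^sup>2 \<le> (\<Sum>j\<in>UNIV. (cmod (comb a (j # u)))\<^sup>2)" for u
  proof -
    define v where "v = (\<chi> j. cnj (comb a (j # u)))"
    have "comb a' u = herm q v" by (simp add: shift herm_def v_def)
    then have "cmod (comb a' u) \<le> norm q * norm v" by (simp add: norm_herm_le)
    also have "\<dots> \<le> norm v" using q mult_right_mono[of "norm q" 1 "norm v"] by simp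
    finally have "(cmod (comb a' u))\<^sup>2 \<le> (norm v)\<^sup>2" by (intro power_mono) auto
    also have "\<dots> = (\<Sum>j\<in>UNIV. (cmod (comb a (j # u)))\<^sup>2)"
      by (simp add: norm_vec_def L2_set_def v_def sum_nonneg)
    finally show ?thesis .
  qed
  have summ: "(\<lambda>u. (cmod (comb c u))\<^sup>2) summable_on UNIV" for c
    using comb_in by (simp add: ell2_iff)
  have summ': "(\<lambda>u. (cmod (comb a (j # u)))\<^sup>2) summable_on UNIV" for j
    by (rule summable_on_words_Cons[OF summ])
  have "(hnorm ell2 (comb a'))\<^sup>2 \<le> (\<Sum>j\<in>UNIV. \<Sum>\<^sub>\<infinity>u. (cmod (comb a (j # u)))\<^sup>2)"
    unfolding hnorm_ell2_sq[OF comb_in]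
    by (rule has_sum_mono[OF has_sum_infsum[OF summ] has_sum_finite_sum[OF finite] shift_le])
      (rule has_sum_infsum[OF summ'])
  also have "\<dots> \<le> (cmod (comb a []))\<^sup>2 + (\<Sum>j\<in>UNIV. \<Sum>\<^sub>\<infinity>u. (cmod (comb a (j # u)))\<^sup>2)"
    by simp
  also have "\<dots> = (hnorm ell2 (comb a))\<^sup>2"
    unfolding hnorm_ell2_sq[OF comb_in]
    by (intro infsumI[symmetric] has_sum_words_Cons has_sum_infsum summ')
  finally have "0 \<le> (hnorm ell2 (comb a))\<^sup>2 - (hnorm ell2 (comb a'))\<^sup>2" by simp
  also have "\<dots> = Re (\<Sum>w\<in>A. \<Sum>u\<in>A. a w * cnj (a u) * da_kernel w u - a' w * cnj (a' u) * da_kernel w u)"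
    unfolding comb_sq by (simp add: sum_subtractf)
  also have "(\<Sum>w\<in>A. \<Sum>u\<in>A. a w * cnj (a u) * da_kernel w u - a' w * cnj (a' u) * da_kernel w u) =
      (\<Sum>w\<in>A. \<Sum>u\<in>A. a w * cnj (a u) * ((1 - herm u q * cnj (herm w q)) * da_kernel w u))"
    by (intro sum.cong refl) (simp add: a'_def algebra_simps)
  finally show "0 \<le> Re (\<Sum>w\<in>A. \<Sum>u\<in>A. a w * cnj (a u) *
      ((1 - herm u q * cnj (herm w q)) * da_kernel w u))" .
qed

locale rkhs =
  fixes X :: "'a set" and k :: "'a \<Rightarrow> 'a \<Rightarrow> complex" and S :: "'a fun_space"
  assumes rkhs: "is_rkhs X k S"

sublocale rkhs \<subseteq> complete_inner_space S
  using rkhs by unfold_locales (auto simp: is_rkhs_def)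

context rkhs
begin

abbreviation K :: "'a \<Rightarrow> 'a \<Rightarrow> complex" where
  "K w \<equiv> zext X (k w)"

lemma points_eq: "points S = X"
  using rkhs by (simp add: is_rkhs_def)

lemma K_in: "w \<in> X \<Longrightarrow> K w \<in> elems S"
  using rkhs by (simp add: is_rkhs_def)

lemma ip_K: "h \<in> elems S \<Longrightarrow> w \<in> X \<Longrightarrow> ip S h (K w) = h w"
  using rkhs by (simp add: is_rkhs_def)

lemma ip_K_left: "h \<in> elems S \<Longrightarrow> w \<in> X \<Longrightarrow> ip S (K w) h = cnj (h w)"
  using ip_commute[OF K_in] ip_K by simp

lemma zero_off: "h \<in> elems S \<Longrightarrow> x \<notin> X \<Longrightarrow> h x = 0"
  using zext_elem[of h] points_eq by (metis zext_def)

lemma combination_in: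
  "finite A \<Longrightarrow> A \<subseteq> X \<Longrightarrow> (\<lambda>x. \<Sum>w\<in>A. a w * K w x) \<in> elems S"
  by (intro sum_in scale_in K_in) auto

lemma ip_combination:
  assumes "finite A" "A \<subseteq> X" "h \<in> elems S"
  shows "ip S (\<lambda>x. \<Sum>w\<in>A. a w * K w x) h = (\<Sum>w\<in>A. a w * cnj (h w))"
proof -
  have "ip S (\<lambda>x. \<Sum>w\<in>A. a w * K w x) h = (\<Sum>w\<in>A. ip S (\<lambda>x. a w * K w x) h)"
    using assms by (intro ip_sum_left scale_in K_in) auto
  also have "\<dots> = (\<Sum>w\<in>A. a w * cnj (h w))"
    using assms by (intro sum.cong refl) (auto simp: ip_scale_left K_in ip_K_left subset_iff)
  finally show ?thesis .
qed

text \<open>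
  The graph of the functional that an interpolant of \<open>t\<close> has to represent consists of the linear
  combinations of kernel functions at points of \<open>V\<close>, each paired with the value that the
  interpolation conditions force.
\<close>

lemma interpolation:
  assumes V: "V \<subseteq> X" and C: "C \<ge> 0"
    and bound: "\<And>A a. finite A \<Longrightarrow> A \<subseteq> V \<Longrightarrow>
      cmod (\<Sum>w\<in>A. a w * cnj (t w)) \<le> C * hnorm S (\<lambda>x. \<Sum>w\<in>A. a w * K w x)"
  obtains u where "u \<in> elems S" "\<And>w. w \<in> V \<Longrightarrow> u w = t w" "hnorm S u \<le> C"
    "\<And>e. e > 0 \<Longrightarrow> \<exists>A a. finite A \<and> A \<subseteq> V \<and> hnorm S (\<lambda>x. u x - (\<Sum>w\<in>A. a w * K w x)) < e"
proof -
  define P where "P = {p. \<exists>A a. finite A \<and> A \<subseteq> V \<and>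
    p = (\<lambda>x. \<Sum>w\<in>A. a w * K w x, \<Sum>w\<in>A. a w * cnj (t w))}"
  have PI: "(\<lambda>x. \<Sum>w\<in>A. a w * K w x, \<Sum>w\<in>A. a w * cnj (t w)) \<in> P"
    if "finite A" "A \<subseteq> V" for A a
    using that by (auto simp: P_def)
  obtain u where u: "u \<in> elems S" "hnorm S u \<le> C"
    and rep: "\<And>v c. (v, c) \<in> P \<Longrightarrow> ip S v u = c"
    and approx: "\<And>e. e > 0 \<Longrightarrow> \<exists>v c. (v, c) \<in> P \<and> hnorm S (\<lambda>x. u x - v x) < e"
  proof (rule riesz_graph[of P C])
    show "(\<lambda>x. 0, 0) \<in> P" using PI[of "{}"] by simp
    fix v c assume p: "(v, c) \<in> P"
    then obtain A a where A: "finite A" "A \<subseteq> V"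
      and v: "v = (\<lambda>x. \<Sum>w\<in>A. a w * K w x)" and c: "c = (\<Sum>w\<in>A. a w * cnj (t w))"
      by (auto simp: P_def)
    show "v \<in> elems S" unfolding v using A V by (intro combination_in) auto
    show "cmod c \<le> C * hnorm S v" unfolding v c using A by (rule bound)
    show "(\<lambda>x. s * v x, s * c) \<in> P" for s
      using PI[OF A, of "\<lambda>w. s * a w"] by (simp add: v c sum_distrib_left mult.assoc)
    fix v' c' assume "(v', c') \<in> P"
    then obtain B b where B: "finite B" "B \<subseteq> V"
      and v': "v' = (\<lambda>x. \<Sum>w\<in>B. b w * K w x)" and c': "c' = (\<Sum>w\<in>B. b w * cnj (t w))"
      by (auto simp: P_def)
    define d where "d = (\<lambda>w. (if w \<in> A then a w else 0) + (if w \<in> B then b w else 0))"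
    \<comment> \<open>Coefficient families with different supports are added on the union of the supports.\<close>
    have merge: "(\<Sum>w\<in>A \<union> B. d w * F w) = (\<Sum>w\<in>A. a w * F w) + (\<Sum>w\<in>B. b w * F w)" for F
    proof -
      have "(\<Sum>w\<in>A \<union> B. d w * F w) =
          (\<Sum>w\<in>A \<union> B. (if w \<in> A then a w * F w else 0)) + (\<Sum>w\<in>A \<union> B. (if w \<in> B then b w * F w else 0))"
        unfolding sum.distrib[symmetric] by (intro sum.cong) (auto simp: d_def distrib_right)
      also have "(\<Sum>w\<in>A \<union> B. (if w \<in> A then a w * F w else 0)) = (\<Sum>w\<in>A. a w * F w)"
        using A B by (intro sum.mono_neutral_cong_right) auto
      also have "(\<Sum>w\<in>A \<union> B. (if w \<in> B then b w * F w else 0)) = (\<Sum>w\<in>B. b w * F w)"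
        using A B by (intro sum.mono_neutral_cong_right) auto
      finally show ?thesis .
    qed
    show "(\<lambda>x. v x + v' x, c + c') \<in> P"
      using PI[of "A \<union> B" d] A B by (simp add: merge v v' c c')
  qed (use C in blast)+
  show thesis
  proof
    show "u w = t w" if w: "w \<in> V" for w
    proof -
      have "ip S (K w) u = cnj (t w)"
        using rep[OF PI[of "{w}" "\<lambda>_. 1"]] w by simp
      then show ?thesis using ip_K_left[OF u(1)] w V by auto
    qed
    show "\<exists>A a. finite A \<and> A \<subseteq> V \<and> hnorm S (\<lambda>x. u x - (\<Sum>w\<in>A. a w * K w x)) < e" if "e > 0" for e
      using approx[OF that] by (auto simp: P_def)
  qed (use u in auto)
qed

text \<open>
  The product \<open>\<phi> h\<close> is found by interpolating its values on all of \<open>X\<close>: the functional that it has to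
  represent is \<open>\<langle>\<cdot>, h\<rangle>\<close> composed with the contraction \<open>k\<^sub>w \<mapsto> cnj \<phi>(w) k\<^sub>w\<close>.
\<close>

lemma schur_multiplier:
  assumes \<phi>: "schur_kernel_pos X k \<phi>" and h: "h \<in> elems S"
  shows "(\<lambda>x. zext X \<phi> x * h x) \<in> elems S \<and> hnorm S (\<lambda>x. zext X \<phi> x * h x) \<le> hnorm S h"
proof -
  obtain u where u: "u \<in> elems S" "\<And>w. w \<in> X \<Longrightarrow> u w = \<phi> w * h w" "hnorm S u \<le> hnorm S h"
  proof (rule interpolation[of X "hnorm S h" "\<lambda>w. \<phi> w * h w"])
    fix A a assume A: "finite A" "A \<subseteq> X"
    define comb where "comb = (\<lambda>c x. \<Sum>w\<in>A. c w * K w x)"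
    have comb_in: "comb c \<in> elems S" for c
      unfolding comb_def[abs_def] using A by (rule combination_in)
    have ip_comb: "ip S (comb c) g = (\<Sum>w\<in>A. c w * cnj (g w))" if "g \<in> elems S" for c g
      unfolding comb_def by (rule ip_combination[OF A that])
    have comb_sq: "(hnorm S (comb c))\<^sup>2 = Re (\<Sum>w\<in>A. \<Sum>u\<in>A. c w * cnj (c u) * k w u)" for c
    proof -
      have "cnj (ip S (comb c) (comb c)) = (\<Sum>u\<in>A. \<Sum>w\<in>A. c w * cnj (c u) * K w u)"
        unfolding ip_comb[OF comb_in]
        by (simp add: comb_def sum_distrib_left mult_ac)
      also have "\<dots> = (\<Sum>w\<in>A. \<Sum>u\<in>A. c w * cnj (c u) * k w u)"
        using A by (subst sum.swap) (auto intro!: sum.cong simp: zext_def)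
      finally show ?thesis
        using hnorm_sq[OF comb_in[of c]] by (metis cnj.simps(1))
    qed
    define a' where "a' = (\<lambda>w. a w * cnj (\<phi> w))"
    have "0 \<le> Re (\<Sum>w\<in>A. \<Sum>u\<in>A. a w * cnj (a u) * ((1 - \<phi> u * cnj (\<phi> w)) * k w u))"
      using \<phi> A unfolding schur_kernel_pos_def by blast
    also have "(\<Sum>w\<in>A. \<Sum>u\<in>A. a w * cnj (a u) * ((1 - \<phi> u * cnj (\<phi> w)) * k w u)) =
        (\<Sum>w\<in>A. \<Sum>u\<in>A. a w * cnj (a u) * k w u) - (\<Sum>w\<in>A. \<Sum>u\<in>A. a' w * cnj (a' u) * k w u)"
      unfolding sum_subtractf[symmetric]
      by (intro sum.cong refl) (simp add: a'_def algebra_simps)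
    finally have "(hnorm S (comb a'))\<^sup>2 \<le> (hnorm S (comb a))\<^sup>2"
      unfolding comb_sq by simp
    then have le: "hnorm S (comb a') \<le> hnorm S (comb a)"
      by (rule power2_le_imp_le) (rule hnorm_nonneg[OF comb_in])
    have "(\<Sum>w\<in>A. a w * cnj (\<phi> w * h w)) = ip S (comb a') h"
      unfolding ip_comb[OF h] by (simp add: a'_def mult.assoc)
    also have "cmod \<dots> \<le> hnorm S (comb a') * hnorm S h"
      by (rule cauchy_schwarz[OF comb_in h])
    also have "\<dots> \<le> hnorm S h * hnorm S (comb a)"
      using le hnorm_nonneg[OF h] by (simp add: mult.commute mult_left_mono)
    finally show "cmod (\<Sum>w\<in>A. a w * cnj (\<phi> w * h w)) \<le> hnorm S h * hnorm S (\<lambda>x. \<Sum>w\<in>A. a w * K w x)"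
      unfolding comb_def .
  qed (use h in auto)
  have "(\<lambda>x. zext X \<phi> x * h x) = u"
    using u(2) zero_off[OF u(1)] by (auto simp: fun_eq_iff zext_def)
  then show ?thesis using u by simp
qed

end

section \<open>Restriction to a subset of the ball\<close>

context
  fixes V :: "(complex ^ 'd) set"
  assumes V: "V \<subseteq> ball 0 1"
begin

interpretation da: rkhs "ball 0 1" da_kernel "drury_arveson :: (complex ^ 'd) fun_space"
  by standard (rule is_rkhs_drury_arveson)

lemma norm_less_1: "x \<in> V \<Longrightarrow> norm x < 1"
  using V by auto

lemma closed_kernel_span_iff:
  "h \<in> closed_kernel_span V \<longleftrightarrow> h \<in> elems drury_arveson \<and>
    (\<forall>e>0. \<exists>A a. finite A \<and> A \<subseteq> V \<and>
      hnorm drury_arveson (\<lambda>x. h x - (\<Sum>w\<in>A. a w * da.K w x)) < e)"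
proof -
  have "(\<exists>g\<in>kernel_span V. Q g) \<longleftrightarrow>
      (\<exists>A a. finite A \<and> A \<subseteq> V \<and> Q (\<lambda>x. \<Sum>w\<in>A. a w * da.K w x))" for Q
    by (auto simp: kernel_span_def)
  then show ?thesis by (simp add: closed_kernel_span_def)
qed

text \<open>
  Linear combinations of kernel functions at points of \<open>V\<close> are orthogonal to \<open>d\<close> by the
  reproducing property, and orthogonality passes to limits.
\<close>

lemma closed_kernel_span_orthogonal:
  assumes h: "h \<in> closed_kernel_span V" and d: "d \<in> elems drury_arveson"
    and dV: "\<And>w. w \<in> V \<Longrightarrow> d w = 0"
  shows "ip drury_arveson h d = 0"
proof -
  have "cmod (ip drury_arveson h d) \<le> e * hnorm drury_arveson d" if e: "e > 0" for e
  proof -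
    obtain A a where A: "finite A" "A \<subseteq> V"
      and less: "hnorm drury_arveson (\<lambda>x. h x - (\<Sum>w\<in>A. a w * da.K w x)) < e"
      using h e unfolding closed_kernel_span_iff by blast
    have comb: "(\<lambda>x. \<Sum>w\<in>A. a w * da.K w x) \<in> elems drury_arveson"
      using A V by (intro da.combination_in) auto
    have h': "h \<in> elems drury_arveson" using h by (simp add: closed_kernel_span_iff)
    have "ip drury_arveson (\<lambda>x. \<Sum>w\<in>A. a w * da.K w x) d = (\<Sum>w\<in>A. a w * cnj (d w))"
      using A V by (intro da.ip_combination d) auto
    also have "\<dots> = 0" using A dV by (intro sum.neutral) auto
    finally have "ip drury_arveson h d = ip drury_arveson (\<lambda>x. h x - (\<Sum>w\<in>A. a w * da.K w x)) d"
      using da.ip_diff_left[OF h' comb d] by simp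
    also have "cmod \<dots> \<le> hnorm drury_arveson (\<lambda>x. h x - (\<Sum>w\<in>A. a w * da.K w x)) * hnorm drury_arveson d"
      by (intro da.cauchy_schwarz da.diff_in h' comb d)
    also have "\<dots> \<le> e * hnorm drury_arveson d"
      using less d by (intro mult_right_mono) auto
    finally show ?thesis .
  qed
  note le = this
  have "cmod (ip drury_arveson h d) \<le> 0"
  proof (rule field_le_epsilon)
    fix e :: real assume e: "e > 0"
    define N where "N = hnorm drury_arveson d + 1"
    have N: "N > 0" using da.hnorm_nonneg[OF d] by (simp add: N_def)
    have "cmod (ip drury_arveson h d) \<le> e / N * hnorm drury_arveson d"
      using e N by (intro le) simp
    also have "\<dots> \<le> e / N * N"
      using e N by (intro mult_left_mono) (auto simp: N_def)
    finally show "cmod (ip drury_arveson h d) \<le> 0 + e" using N by simp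
  qed
  then show ?thesis by simp
qed

lemma inj_on_closed_kernel_span: "inj_on (zext V) (closed_kernel_span V)"
proof (rule inj_onI)
  fix g h assume g: "g \<in> closed_kernel_span V" and h: "h \<in> closed_kernel_span V"
    and eq: "zext V g = zext V h"
  have gS: "g \<in> elems drury_arveson" and hS: "h \<in> elems drury_arveson"
    using g h by (simp_all add: closed_kernel_span_iff)
  define d where "d = (\<lambda>x. g x - h x)"
  have d: "d \<in> elems drury_arveson" unfolding d_def using gS hS by (rule da.diff_in)
  have dV: "d w = 0" if "w \<in> V" for w
    using fun_cong[OF eq, of w] that by (simp add: d_def zext_def)
  have "ip drury_arveson d d = ip drury_arveson g d - ip drury_arveson h d"
    using da.ip_diff_left[OF gS hS d] by (simp only: d_def)
  also have "\<dots> = 0"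
    using closed_kernel_span_orthogonal[OF g d dV] closed_kernel_span_orthogonal[OF h d dV] by simp
  finally have "d = (\<lambda>x. 0)"
    using da.hnorm_eq_0[OF d] by (simp add: hnorm_def)
  then show "g = h" by (simp add: d_def fun_eq_iff)
qed

lemma H_on_elems: "elems (H_on V) = zext V ` closed_kernel_span V"
  by (simp add: H_on_def Let_def)

lemma hnorm_H_on:
  assumes "h \<in> closed_kernel_span V"
  shows "hnorm (H_on V) (zext V h) = hnorm drury_arveson h"
  using the_inv_into_f_f[OF inj_on_closed_kernel_span assms]
  by (simp add: hnorm_def H_on_def Let_def)

text \<open>
  The orthogonal projection onto the closed span, obtained by interpolating the values of \<open>h\<close>
  on \<open>V\<close>.
\<close>

lemma projection:
  assumes h: "h \<in> elems drury_arveson"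
  obtains p where "p \<in> closed_kernel_span V" "zext V p = zext V h"
    "hnorm drury_arveson p \<le> hnorm drury_arveson h"
proof -
  obtain p where p: "p \<in> elems drury_arveson" "\<And>w. w \<in> V \<Longrightarrow> p w = h w"
      "hnorm drury_arveson p \<le> hnorm drury_arveson h"
    and approx: "\<And>e. e > 0 \<Longrightarrow> \<exists>A a. finite A \<and> A \<subseteq> V \<and>
      hnorm drury_arveson (\<lambda>x. p x - (\<Sum>w\<in>A. a w * da.K w x)) < e"
  proof (rule da.interpolation[of V "hnorm drury_arveson h" h])
    fix A a assume A: "finite A" "A \<subseteq> V"
    then have A': "A \<subseteq> ball 0 1" using V by auto
    show "cmod (\<Sum>w\<in>A. a w * cnj (h w)) \<le>
        hnorm drury_arveson h * hnorm drury_arveson (\<lambda>x. \<Sum>w\<in>A. a w * da.K w x)"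
      using da.cauchy_schwarz[OF da.combination_in[OF A(1) A'] h, of a]
      unfolding da.ip_combination[OF A(1) A' h] by (simp add: mult.commute)
  qed (use V h in auto)
  show thesis
  proof
    show "p \<in> closed_kernel_span V" using p approx by (simp add: closed_kernel_span_iff)
    show "zext V p = zext V h" using p by (auto simp: zext_def)
  qed (rule p)
qed

lemma kernel_in_closed_kernel_span:
  assumes "x \<in> V"
  shows "(\<lambda>z. c * da.K x z) \<in> closed_kernel_span V"
  unfolding closed_kernel_span_iff
proof (intro conjI allI impI)
  show "(\<lambda>z. c * da.K x z) \<in> elems drury_arveson"
    using assms V by (intro da.scale_in da.K_in) auto
  show "\<exists>A a. finite A \<and> A \<subseteq> V \<and>
      hnorm drury_arveson (\<lambda>z. c * da.K x z - (\<Sum>w\<in>A. a w * da.K w z)) < e" if "e > 0" for e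
    using assms that by (intro exI[of _ "{x}"] exI[of _ "\<lambda>_. c"]) simp
qed

lemma schur_multiplier_M_on:
  assumes \<phi>: "schur_kernel_pos (ball 0 1) da_kernel \<phi>"
  shows "zext V \<phi> \<in> M_on V" "M_on_norm V (zext V \<phi>) \<le> 1"
proof -
  have "zext (ball 0 1) \<phi> \<in> da_multipliers"
    unfolding da_multipliers_def multipliers_def
    using da.schur_multiplier[OF \<phi>] by (auto simp: da.points_eq zext_def)
  moreover have "zext V (zext (ball 0 1) \<phi>) = zext V \<phi>"
    by (auto simp: zext_def norm_less_1)
  ultimately show "zext V \<phi> \<in> M_on V" unfolding M_on_def by (metis imageI)
  show "M_on_norm V (zext V \<phi>) \<le> 1"
    unfolding M_on_norm_def mult_norm_def
  proof (rule SUP_least)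
    fix g assume "g \<in> {h \<in> elems (H_on V). hnorm (H_on V) h \<le> 1}"
    then obtain h where h: "h \<in> closed_kernel_span V" and g: "g = zext V h"
      and h1: "hnorm drury_arveson h \<le> 1"
      unfolding H_on_elems by (auto simp: hnorm_H_on)
    have hS: "h \<in> elems drury_arveson" using h by (simp add: closed_kernel_span_iff)
    obtain p where p: "p \<in> closed_kernel_span V"
      "zext V p = zext V (\<lambda>x. zext (ball 0 1) \<phi> x * h x)"
      "hnorm drury_arveson p \<le> hnorm drury_arveson (\<lambda>x. zext (ball 0 1) \<phi> x * h x)"
      by (rule projection[OF conjunct1[OF da.schur_multiplier[OF \<phi> hS]]])
    have "(\<lambda>x. zext V \<phi> x * g x) = zext V p"
      unfolding p(2) by (auto simp: g zext_def fun_eq_iff norm_less_1)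
    then have "hnorm (H_on V) (\<lambda>x. zext V \<phi> x * g x) = hnorm drury_arveson p"
      by (simp only: hnorm_H_on[OF p(1)])
    then have "hnorm (H_on V) (\<lambda>x. zext V \<phi> x * g x) \<le> 1"
      using p(3) h1 conjunct2[OF da.schur_multiplier[OF \<phi> hS]] by linarith
    then show "ennreal (hnorm (H_on V) (\<lambda>x. zext V \<phi> x * g x)) \<le> 1"
      by (simp add: ennreal_le_1)
  qed
qed

text \<open>
  Let \<open>p\<close> be the product of \<open>\<psi>\<close> with the normalized kernel function at \<open>x\<close>. Because \<open>p\<close> vanishes at
  \<open>y\<close>, its value at \<open>x\<close> is unchanged when it is paired, instead of with \<open>k\<^sub>x\<close>, with the part
  \<open>r\<close> of \<open>k\<^sub>x\<close> orthogonal to \<open>k\<^sub>y\<close>. The ratio of the norms of \<open>r\<close> and \<open>k\<^sub>x\<close> is the pseudohyperbolic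
  distance.
\<close>

lemma two_point_estimate:
  assumes \<psi>: "\<psi> \<in> M_on V" and C: "M_on_norm V \<psi> \<le> ennreal C" "C \<ge> 0"
    and x: "x \<in> V" and y: "y \<in> V" and \<psi>y: "\<psi> y = 0"
  shows "(cmod (\<psi> x))\<^sup>2 \<le>
    C\<^sup>2 * (1 - (1 - (norm x)\<^sup>2) * (1 - (norm y)\<^sup>2) / (cmod (1 - herm x y))\<^sup>2)"
proof -
  obtain \<phi> where \<phi>: "\<phi> \<in> da_multipliers" "\<psi> = zext V \<phi>"
    using \<psi> by (auto simp: M_on_def)
  have xy: "x \<in> ball 0 1" "y \<in> ball 0 1" using x y V by auto
  let ?ip = "ip (drury_arveson :: (complex ^ 'd) fun_space)"
  let ?n = "hnorm (drury_arveson :: (complex ^ 'd) fun_space)"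
  have diag: "da_kernel z z = of_real (1 / (1 - (norm z)\<^sup>2))" for z :: "complex ^ 'd"
    by (simp add: da_kernel_def herm_self)
  have pos: "1 - (norm z)\<^sup>2 > 0" if "z \<in> ball 0 1" for z :: "complex ^ 'd"
    using that by (simp add: abs_square_less_1)
  have nK: "(?n (da.K z))\<^sup>2 = 1 / (1 - (norm z)\<^sup>2)" if z: "z \<in> ball 0 1" for z
    unfolding da.hnorm_sq[OF da.K_in[OF z]] da.ip_K[OF da.K_in[OF z] z]
    using z by (simp add: zext_def diag)
  define N where "N = ?n (da.K x)"
  have N2: "N\<^sup>2 = 1 / (1 - (norm x)\<^sup>2)" unfolding N_def by (rule nK[OF xy(1)])
  have "N\<^sup>2 > 0" unfolding N2 using pos[OF xy(1)] by simp
  then have N: "N > 0" using da.hnorm_nonneg[OF da.K_in[OF xy(1)]] by (simp add: N_def less_le)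
  define h where "h = (\<lambda>z. of_real (1 / N) * da.K x z)"
  have h: "h \<in> closed_kernel_span V"
    unfolding h_def by (rule kernel_in_closed_kernel_span[OF x])
  have hS: "h \<in> elems drury_arveson" using h by (simp add: closed_kernel_span_iff)
  have h1: "?n h = 1"
    unfolding h_def da.hnorm_scale[OF da.K_in[OF xy(1)]] using N by (simp add: N_def norm_divide)
  obtain p where p: "p \<in> closed_kernel_span V" "zext V p = zext V (\<lambda>z. \<phi> z * h z)"
    using projection[of "\<lambda>z. \<phi> z * h z"] \<phi>(1) hS by (auto simp: da_multipliers_def multipliers_def)
  have pS: "p \<in> elems drury_arveson" using p(1) by (simp add: closed_kernel_span_iff)
  have pV: "p z = \<psi> z * h z" if "z \<in> V" for z
    using fun_cong[OF p(2), of z] that by (simp add: \<phi>(2) zext_def)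
  have "(\<lambda>z. \<psi> z * zext V h z) = zext V p"
    using pV by (auto simp: zext_def \<phi>(2))
  then have "ennreal (?n p) \<le> M_on_norm V \<psi>"
    unfolding M_on_norm_def mult_norm_def
    using h h1 by (intro SUP_upper2[of "zext V h"]) (auto simp: H_on_elems hnorm_H_on p(1))
  then have pC: "?n p \<le> C"
    using C order.trans by (metis ennreal_le_iff)
  have px: "p x = \<psi> x * of_real N"
  proof -
    have "da.K x x = of_real (N\<^sup>2)"
      using xy by (simp only: zext_def diag N2 if_True)
    then show ?thesis using N by (simp add: pV[OF x] h_def power2_eq_square)
  qed
  have py: "p y = 0" by (simp add: pV[OF y] \<psi>y)
  \<comment> \<open>The coefficient of the orthogonal projection of \<open>k\<^sub>x\<close> onto the line of \<open>k\<^sub>y\<close>.\<close>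
  define \<beta> where "\<beta> = of_real (1 - (norm y)\<^sup>2) * da_kernel x y"
  define r where "r = (\<lambda>z. da.K x z - \<beta> * da.K y z)"
  have rS: "r \<in> elems drury_arveson"
    unfolding r_def by (intro da.diff_in da.scale_in da.K_in xy)
  have "?ip p r = p x"
    unfolding r_def using xy pS
    by (simp add: da.ip_diff_right da.ip_scale_right da.K_in da.scale_in da.ip_K py)
  then have "cmod (\<psi> x) * N \<le> ?n p * ?n r"
    using da.cauchy_schwarz[OF pS rS] N by (simp add: px norm_mult)
  also have "\<dots> \<le> C * ?n r"
    using pC da.hnorm_nonneg[OF rS] by (rule mult_right_mono)
  finally have "(cmod (\<psi> x) * N)\<^sup>2 \<le> (C * ?n r)\<^sup>2"
    using N by (intro power_mono) auto
  moreover have "(?n r)\<^sup>2 = N\<^sup>2 * (1 - (1 - (norm x)\<^sup>2) * (1 - (norm y)\<^sup>2) / (cmod (1 - herm x y))\<^sup>2)"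
  proof -
    define m where "m = cmod (da_kernel x y)"
    have m2: "m\<^sup>2 = 1 / (cmod (1 - herm x y))\<^sup>2"
      unfolding m_def da_kernel_def herm_commute[of y x]
      by (metis complex_cnj_diff complex_cnj_one complex_mod_cnj norm_divide norm_one power_one_over)
    have "(?n r)\<^sup>2 = N\<^sup>2 - 2 * Re (cnj \<beta> * da_kernel x y) + (cmod \<beta>)\<^sup>2 * (?n (da.K y))\<^sup>2"
      unfolding r_def da.hnorm_sq_diff[OF da.K_in[OF xy(1)] da.scale_in[OF da.K_in[OF xy(2)]]]
        da.ip_scale_right[OF da.K_in[OF xy(2)] da.K_in[OF xy(1)]] da.ip_K[OF da.K_in[OF xy(1)] xy(2)]
        da.hnorm_scale[OF da.K_in[OF xy(2)]] power_mult_distrib N_def[symmetric]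
      using xy(2) by (simp add: zext_def)
    also have "cnj \<beta> * da_kernel x y = of_real ((1 - (norm y)\<^sup>2) * m\<^sup>2)"
      unfolding \<beta>_def m_def complex_cnj_mult complex_cnj_complex_of_real of_real_mult
        complex_norm_square by (simp only: mult_ac)
    also have "(cmod \<beta>)\<^sup>2 * (?n (da.K y))\<^sup>2 = (1 - (norm y)\<^sup>2) * m\<^sup>2"
      unfolding nK[OF xy(2)] \<beta>_def norm_mult norm_of_real m_def[symmetric]
      using pos[OF xy(2)] by (simp add: power2_eq_square)
    finally have "(?n r)\<^sup>2 = N\<^sup>2 - (1 - (norm y)\<^sup>2) * m\<^sup>2" by simp
    also have "\<dots> = N\<^sup>2 * (1 - (1 - (norm x)\<^sup>2) * (1 - (norm y)\<^sup>2) * m\<^sup>2)"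
      unfolding N2 using pos[OF xy(1)] by (simp add: field_simps)
    finally show ?thesis by (simp add: m2)
  qed
  ultimately have "N\<^sup>2 * (cmod (\<psi> x))\<^sup>2 \<le> N\<^sup>2 *
      (C\<^sup>2 * (1 - (1 - (norm x)\<^sup>2) * (1 - (norm y)\<^sup>2) / (cmod (1 - herm x y))\<^sup>2))"
    by (simp only: power_mult_distrib mult_ac)
  then show ?thesis using N by simp
qed

end

section \<open>Boundary behaviour of an embedded disc\<close>

lemma has_vector_derivative_right_quotient:
  fixes G :: "real \<Rightarrow> 'a::real_normed_vector"
  assumes "(G has_vector_derivative D) (at 0 within {0..T})" "T > 0"
  shows "((\<lambda>t. (G t - G 0) /\<^sub>R t) \<longlongrightarrow> D) (at_right 0)"
proof -
  have "((\<lambda>t. norm (G t - G 0 - (t - 0) *\<^sub>R D) / norm (t - 0)) \<longlongrightarrow> 0) (at_right 0)"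
    using assms unfolding has_vector_derivative_def has_derivative_iff_norm
    by (simp add: at_within_Icc_at_right)
  moreover have "eventually (\<lambda>t. norm (G t - G 0 - (t - 0) *\<^sub>R D) / norm (t - 0) =
      norm ((G t - G 0) /\<^sub>R t - D)) (at_right 0)"
    unfolding eventually_at_filter
  proof (intro always_eventually allI impI)
    fix t :: real assume t: "t \<noteq> 0" "t \<in> {0<..}"
    have "(G t - G 0) /\<^sub>R t - D = (G t - G 0 - (t - 0) *\<^sub>R D) /\<^sub>R t"
      using t by (simp add: scaleR_diff_right)
    then show "norm (G t - G 0 - (t - 0) *\<^sub>R D) / norm (t - 0) = norm ((G t - G 0) /\<^sub>R t - D)"
      using t by (simp add: divide_inverse mult.commute)
  qed
  ultimately have "((\<lambda>t. norm ((G t - G 0) /\<^sub>R t - D)) \<longlongrightarrow> 0) (at_right 0)"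
    by (rule Lim_transform_eventually)
  then show ?thesis
    by (simp only: tendsto_norm_zero_iff LIM_zero_iff)
qed

lemma norm_inward_less_1:
  assumes "cmod \<xi> = 1" "0 < t" "t * (cmod \<zeta>)\<^sup>2 < 2 * Re \<zeta>"
  shows "cmod (\<xi> - of_real t * (\<zeta> * \<xi>)) < 1"
proof -
  have "\<xi> - of_real t * (\<zeta> * \<xi>) = (1 - of_real t * \<zeta>) * \<xi>" by (simp add: algebra_simps)
  then have "(cmod (\<xi> - of_real t * (\<zeta> * \<xi>)))\<^sup>2 = (cmod (1 - of_real t * \<zeta>))\<^sup>2"
    using assms by (simp add: norm_mult)
  also have "\<dots> = 1 - t * (2 * Re \<zeta> - t * (cmod \<zeta>)\<^sup>2)"
    unfolding cmod_power2 by (simp add: power2_eq_square algebra_simps)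
  also have "\<dots> < 1\<^sup>2" using assms by simp
  finally show ?thesis by (rule power_less_imp_less_base) simp
qed

lemma eventually_inward:
  assumes "cmod \<xi> = 1" "Re \<zeta> > 0"
  shows "eventually (\<lambda>t. \<xi> - of_real t * (\<zeta> * \<xi>) \<in> ball 0 1) (at_right 0)"
proof -
  have "((\<lambda>t::real. t * (cmod \<zeta>)\<^sup>2) \<longlongrightarrow> 0 * (cmod \<zeta>)\<^sup>2) (at_right 0)"
    by (intro tendsto_intros)
  then have "eventually (\<lambda>t::real. t * (cmod \<zeta>)\<^sup>2 < 2 * Re \<zeta>) (at_right 0)"
    using assms by (intro order_tendstoD(2)) auto
  moreover have "eventually (\<lambda>t::real. t > 0) (at_right 0)"
    by (simp add: eventually_at_filter)
  ultimately show ?thesis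
    by eventually_elim (use norm_inward_less_1[OF assms(1)] in auto)
qed

text \<open>
  At the boundary point itself \<open>h\<close> has no derivative in the usual sense. The fundamental theorem of
  calculus on the segment \<open>\<xi> (1 - t \<zeta>)\<close>, whose interior lies in the open disc, expresses the
  increment of \<open>h\<close> as the integral of a function that is continuous up to \<open>t = 0\<close>.
\<close>

lemma holomorphic_boundary_quotient:
  assumes hol: "h holomorphic_on ball 0 1" and cont: "continuous_on (cball 0 1) h"
    and cont1: "continuous_on (cball 0 1) h1" and h1: "\<And>z. z \<in> ball 0 1 \<Longrightarrow> h1 z = deriv h z"
    and \<xi>: "cmod \<xi> = 1" and \<zeta>: "Re \<zeta> > 0"
  shows "((\<lambda>t. (h \<xi> - h (\<xi> - of_real t * (\<zeta> * \<xi>))) /\<^sub>R t) \<longlongrightarrow> \<zeta> * (\<xi> * h1 \<xi>)) (at_right 0)"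
proof -
  have z0: "\<zeta> \<noteq> 0" using \<zeta> by auto
  define T where "T = Re \<zeta> / (cmod \<zeta>)\<^sup>2"
  have T: "T > 0" using \<zeta> z0 by (simp add: T_def)
  define \<gamma> where "\<gamma> = (\<lambda>t. \<xi> - of_real t * (\<zeta> * \<xi>))"
  have ball: "\<gamma> t \<in> ball 0 1" if "0 < t" "t \<le> T" for t
  proof -
    have "t * (cmod \<zeta>)\<^sup>2 \<le> Re \<zeta>" using that(2) z0 by (simp add: T_def field_simps)
    then have "t * (cmod \<zeta>)\<^sup>2 < 2 * Re \<zeta>" using \<zeta> by simp
    then show ?thesis using norm_inward_less_1[OF \<xi> that(1)] by (simp add: \<gamma>_def)
  qed
  have cball: "\<gamma> t \<in> cball 0 1" if "0 \<le> t" "t \<le> T" for t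
  proof (cases "t = 0")
    case True then show ?thesis using \<xi> by (simp add: \<gamma>_def)
  next
    case False then show ?thesis using ball[of t] that by (simp add: less_imp_le)
  qed
  have cont_\<gamma>: "continuous_on {0..T} \<gamma>"
    unfolding \<gamma>_def by (intro continuous_intros)
  define G where "G = (\<lambda>t. h (\<gamma> t))"
  define G' where "G' = (\<lambda>t. - (\<zeta> * (\<xi> * h1 (\<gamma> t))))"
  have contG: "continuous_on {0..T} G"
    unfolding G_def using cball by (intro continuous_on_compose2[OF cont cont_\<gamma>]) auto
  have contG': "continuous_on {0..T} G'"
    unfolding G'_def using cball
    by (intro continuous_intros continuous_on_compose2[OF cont1 cont_\<gamma>]) auto
  have derG: "(G has_vector_derivative G' t) (at t)" if t: "t \<in> {0<..<T}" for t
  proof -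
    have b: "\<gamma> t \<in> ball 0 1" using ball[of t] t by simp
    have "(\<gamma> has_vector_derivative - (\<zeta> * \<xi>)) (at t)"
      unfolding \<gamma>_def by (auto intro!: derivative_eq_intros simp: has_vector_derivative_def scaleR_conv_of_real)
    moreover have "(h has_field_derivative h1 (\<gamma> t)) (at (\<gamma> t))"
      unfolding h1[OF b] using holomorphic_derivI[OF hol open_ball b] .
    ultimately have "((h \<circ> \<gamma>) has_vector_derivative (- (\<zeta> * \<xi>) * h1 (\<gamma> t))) (at t)"
      by (rule field_vector_diff_chain_at)
    then show ?thesis by (simp add: G_def G'_def o_def mult.assoc)
  qed
  have int: "(G' has_integral (G u - G 0)) {0..u}" if u: "u \<in> {0..T}" for u
    using u by (intro fundamental_theorem_of_calculus_interior derG continuous_on_subset[OF contG]) auto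
  have "((\<lambda>u. integral {0..u} G') has_vector_derivative G' 0) (at 0 within {0..T})"
    using T by (intro integral_has_vector_derivative contG') simp
  then have "((\<lambda>u. G u - G 0) has_vector_derivative G' 0) (at 0 within {0..T})"
    by (rule has_vector_derivative_transform[rotated 2]) (use T integral_unique[OF int] in auto)
  from tendsto_minus[OF has_vector_derivative_right_quotient[OF this T]]
  show ?thesis
    by (simp add: G_def G'_def \<gamma>_def flip: scaleR_minus_right)
qed

lemma tendsto_herm [tendsto_intros]:
  "(F \<longlongrightarrow> a) net \<Longrightarrow> (G \<longlongrightarrow> b) net \<Longrightarrow> ((\<lambda>t. herm (F t) (G t)) \<longlongrightarrow> herm a b) net"
  unfolding herm_def by (intro tendsto_intros)

lemma herm_scale_right: "herm x (c *s y) = cnj c * herm x y"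
  by (simp add: herm_def sum_distrib_left mult_ac)

lemma herm_scale_left: "herm (c *s x) y = c * herm x y"
  by (simp add: herm_def sum_distrib_left mult_ac)

lemma herm_scaleR_left: "herm (r *\<^sub>R x) y = of_real r * herm x y"
  unfolding herm_def vector_scaleR_component scaleR_conv_of_real[where 'a = complex]
  by (simp add: sum_distrib_left mult_ac)

lemma herm_scaleR_right: "herm x (r *\<^sub>R y) = of_real r * herm x y"
  unfolding herm_def vector_scaleR_component scaleR_conv_of_real[where 'a = complex]
  by (simp add: sum_distrib_left mult_ac)

lemma herm_diff_left: "herm (x - y) z = herm x z - herm y z"
  by (simp add: herm_def sum_subtractf left_diff_distrib)

lemma herm_diff_right: "herm z (x - y) = herm z x - herm z y"
  by (simp add: herm_def sum_subtractf right_diff_distrib)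

text \<open>
  Since \<open>\<langle>p, p\<rangle> = 1\<close>, the numerator is \<open>\<langle>p - F, p\<rangle> + \<langle>F, p - G\<rangle>\<close>, so only first-order
  information on \<open>F\<close> and \<open>G\<close> enters.
\<close>

lemma tendsto_one_minus_herm_quotient:
  fixes p :: "complex ^ 'd"
  assumes F: "(F \<longlongrightarrow> p) net" and FU: "((\<lambda>t. (p - F t) /\<^sub>R t) \<longlongrightarrow> U) net"
    and GV: "((\<lambda>t. (p - G t) /\<^sub>R t) \<longlongrightarrow> V) net" and p: "norm p = 1"
  shows "((\<lambda>t. (1 - herm (F t) (G t)) / of_real t) \<longlongrightarrow> herm U p + herm p V) net"
proof -
  have "(1 - herm (F t) (G t)) / of_real t = herm ((p - F t) /\<^sub>R t) p + herm (F t) ((p - G t) /\<^sub>R t)" for t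
  proof -
    have "herm p p = 1" using p by (simp add: herm_self)
    then have "1 - herm (F t) (G t) = herm (p - F t) p + herm (F t) (p - G t)"
      by (simp add: herm_diff_left herm_diff_right)
    then show ?thesis
      unfolding herm_scaleR_left herm_scaleR_right
      by (simp only: divide_inverse distrib_right of_real_inverse mult.commute[of "inverse _"])
  qed
  then show ?thesis
    by (simp only:) (intro tendsto_intros F FU GV)
qed

locale embedded_disc =
  fixes V :: "(complex ^ 'd) set" and f :: "complex \<Rightarrow> complex ^ 'd"
  assumes emb: "disc_embedding V f"
begin

lemma norm_f: "x \<in> cball 0 1 \<Longrightarrow> norm (f x) = 1 \<longleftrightarrow> norm x = 1"
  using emb by (simp add: disc_embedding_def)

lemma f_in_ball: "z \<in> ball 0 1 \<Longrightarrow> f z \<in> ball 0 1"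
  using emb unfolding disc_embedding_def by blast

lemma f_image: "f ` ball 0 1 \<subseteq> ball 0 1"
  using f_in_ball by blast

lemma f_inj: "inj_on f (ball 0 1)"
  using emb by (simp add: disc_embedding_def)

lemma f_holomorphic: "(\<lambda>z. f z $ j) holomorphic_on ball 0 1"
  using emb by (simp add: disc_embedding_def)

lemma f_continuous: "continuous_on (cball 0 1) f"
  using emb by (simp add: disc_embedding_def C2_up_to_boundary_def)

lemma boundary_tendsto:
  assumes \<xi>: "cmod \<xi> = 1" and \<zeta>: "Re \<zeta> > 0"
  shows "((\<lambda>t. f (\<xi> - of_real t * (\<zeta> * \<xi>))) \<longlongrightarrow> f \<xi>) (at_right 0)"
proof (rule continuous_on_tendsto_compose[OF f_continuous])
  have "((\<lambda>t::real. \<xi> - of_real t * (\<zeta> * \<xi>)) \<longlongrightarrow> \<xi> - of_real 0 * (\<zeta> * \<xi>)) (at_right 0)"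
    by (intro tendsto_intros)
  then show "((\<lambda>t::real. \<xi> - of_real t * (\<zeta> * \<xi>)) \<longlongrightarrow> \<xi>) (at_right 0)" by simp
  show "\<xi> \<in> cball 0 1" using \<xi> by simp
  show "eventually (\<lambda>t. \<xi> - of_real t * (\<zeta> * \<xi>) \<in> cball 0 1) (at_right 0)"
    using eventually_inward[OF assms] by eventually_elim simp
qed

lemma boundary_quotient:
  assumes \<xi>: "cmod \<xi> = 1" and \<zeta>: "Re \<zeta> > 0"
  shows "((\<lambda>t. (f \<xi> - f (\<xi> - of_real t * (\<zeta> * \<xi>))) /\<^sub>R t) \<longlongrightarrow>
    \<zeta> *s (\<xi> *s vderiv_ext f \<xi>)) (at_right 0)"
proof -
  obtain f1 where f1: "continuous_on (cball 0 1) f1" "\<And>z. z \<in> ball 0 1 \<Longrightarrow> f1 z = vderiv f z"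
    using emb unfolding disc_embedding_def C2_up_to_boundary_def by blast
  have "(f1 \<longlongrightarrow> f1 \<xi>) (at \<xi> within ball 0 1)"
  proof (rule tendsto_within_subset)
    show "(f1 \<longlongrightarrow> f1 \<xi>) (at \<xi> within cball 0 1)"
      using f1(1) \<xi> by (simp add: continuous_on_def)
  qed (rule ball_subset_cball)
  then have "(vderiv f \<longlongrightarrow> f1 \<xi>) (at \<xi> within ball 0 1)"
    by (rule Lim_transform_within[OF _ zero_less_one]) (simp add: f1(2))
  moreover have "\<not> trivial_limit (at \<xi> within ball 0 1)"
    using \<xi> by (simp add: trivial_limit_within islimpt_ball)
  ultimately have ext: "vderiv_ext f \<xi> = f1 \<xi>"
    using \<xi> by (simp add: vderiv_ext_def tendsto_Lim)
  show ?thesis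
  proof (rule vec_tendstoI)
    fix j
    have "((\<lambda>t. (f \<xi> $ j - f (\<xi> - of_real t * (\<zeta> * \<xi>)) $ j) /\<^sub>R t) \<longlongrightarrow> \<zeta> * (\<xi> * f1 \<xi> $ j)) (at_right 0)"
    proof (rule holomorphic_boundary_quotient[OF f_holomorphic _ _ _ \<xi> \<zeta>])
      show "continuous_on (cball 0 1) (\<lambda>z. f z $ j)" "continuous_on (cball 0 1) (\<lambda>z. f1 z $ j)"
        by (intro continuous_intros f_continuous f1)+
      show "f1 z $ j = deriv (\<lambda>z. f z $ j) z" if "z \<in> ball 0 1" for z
        using f1(2)[OF that] by (simp add: vderiv_def)
    qed
    then show "((\<lambda>t. ((f \<xi> - f (\<xi> - of_real t * (\<zeta> * \<xi>))) /\<^sub>R t) $ j) \<longlongrightarrow>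
        (\<zeta> *s (\<xi> *s vderiv_ext f \<xi>)) $ j) (at_right 0)"
      by (simp add: ext mult.assoc)
  qed
qed

lemma one_minus_herm_quotient:
  assumes \<xi>: "cmod \<xi> = 1" "cmod \<eta> = 1" and s: "s > 0" "r > 0" and eq: "f \<xi> = f \<eta>"
  shows "((\<lambda>t. (1 - herm (f (\<xi> - of_real t * (of_real s * \<xi>))) (f (\<eta> - of_real t * (of_real r * \<eta>)))) / of_real t)
    \<longlongrightarrow> of_real s * cnj (crossing_coeff f \<xi>) + of_real r * crossing_coeff f \<eta>) (at_right 0)"
proof -
  have "((\<lambda>t. (1 - herm (f (\<xi> - of_real t * (of_real s * \<xi>))) (f (\<eta> - of_real t * (of_real r * \<eta>)))) / of_real t)
    \<longlongrightarrow> herm (of_real s *s (\<xi> *s vderiv_ext f \<xi>)) (f \<xi>) + herm (f \<xi>) (of_real r *s (\<eta> *s vderiv_ext f \<eta>))) (at_right 0)"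
  proof (rule tendsto_one_minus_herm_quotient)
    show "norm (f \<xi>) = 1" using norm_f[of \<xi>] \<xi> by simp
    show "((\<lambda>t. (f \<xi> - f (\<eta> - of_real t * (of_real r * \<eta>))) /\<^sub>R t) \<longlongrightarrow>
      of_real r *s (\<eta> *s vderiv_ext f \<eta>)) (at_right 0)"
      unfolding eq using \<xi> s by (intro boundary_quotient) auto
    show "((\<lambda>t. f (\<xi> - of_real t * (of_real s * \<xi>))) \<longlongrightarrow> f \<xi>) (at_right 0)"
      using \<xi> s by (intro boundary_tendsto) auto
    show "((\<lambda>t. (f \<xi> - f (\<xi> - of_real t * (of_real s * \<xi>))) /\<^sub>R t) \<longlongrightarrow>
      of_real s *s (\<xi> *s vderiv_ext f \<xi>)) (at_right 0)"
      using \<xi> s by (intro boundary_quotient) auto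
  qed
  moreover have "herm (of_real s *s (\<xi> *s vderiv_ext f \<xi>)) (f \<xi>) = of_real s * cnj (crossing_coeff f \<xi>)"
    unfolding herm_scale_left[of "of_real s"] crossing_coeff_def herm_commute[of "\<xi> *s _"] ..
  moreover have "herm (f \<xi>) (of_real r *s (\<eta> *s vderiv_ext f \<eta>)) = of_real r * crossing_coeff f \<eta>"
    unfolding herm_scale_right[of _ "of_real r"] crossing_coeff_def eq by simp
  ultimately show ?thesis by (simp only:)
qed

lemma one_minus_herm_boundary_quotient:
  assumes \<xi>: "cmod \<xi> = 1" and \<zeta>: "Re \<zeta> > 0"
  shows "((\<lambda>t. (1 - herm (f (\<xi> - of_real t * (\<zeta> * \<xi>))) (f \<xi>)) / of_real t)
    \<longlongrightarrow> \<zeta> * cnj (crossing_coeff f \<xi>)) (at_right 0)"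
proof -
  have "((\<lambda>t. (1 - herm (f (\<xi> - of_real t * (\<zeta> * \<xi>))) (f \<xi>)) / of_real t)
    \<longlongrightarrow> herm (\<zeta> *s (\<xi> *s vderiv_ext f \<xi>)) (f \<xi>) + herm (f \<xi>) 0) (at_right 0)"
  proof (rule tendsto_one_minus_herm_quotient)
    show "norm (f \<xi>) = 1" using norm_f[of \<xi>] \<xi> by simp
    show "((\<lambda>t. f (\<xi> - of_real t * (\<zeta> * \<xi>))) \<longlongrightarrow> f \<xi>) (at_right 0)"
      using assms by (rule boundary_tendsto)
    show "((\<lambda>t. (f \<xi> - f (\<xi> - of_real t * (\<zeta> * \<xi>))) /\<^sub>R t) \<longlongrightarrow>
      \<zeta> *s (\<xi> *s vderiv_ext f \<xi>)) (at_right 0)"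
      using assms by (rule boundary_quotient)
    show "((\<lambda>t. (f \<xi> - f \<xi>) /\<^sub>R t) \<longlongrightarrow> 0) (at_right 0)" by simp
  qed
  moreover have "herm (\<zeta> *s (\<xi> *s vderiv_ext f \<xi>)) (f \<xi>) = \<zeta> * cnj (crossing_coeff f \<xi>)"
    unfolding herm_scale_left[of \<zeta>] crossing_coeff_def herm_commute[of "\<xi> *s _"] ..
  moreover have "herm (f \<xi>) 0 = 0" by (simp add: herm_def)
  ultimately show ?thesis by (simp only: add_0_right)
qed

end

lemma cmod_moebius_identity:
  "(cmod (1 - cnj a * b))\<^sup>2 - (cmod (b - a))\<^sup>2 = (1 - (cmod a)\<^sup>2) * (1 - (cmod b)\<^sup>2)"
  unfolding cmod_power2 by (simp add: power2_eq_square algebra_simps)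

text \<open>
  The Schwarz lemma for \<open>b\<close> followed by the disc automorphism that takes \<open>b 0\<close> to zero. It is the
  quantitative reason why the radial derivative of \<open>b\<close> at a boundary point does not vanish.
\<close>

lemma schwarz_boundary_lower_bound:
  assumes hol: "b holomorphic_on ball 0 1" and b1: "\<And>z. norm z < 1 \<Longrightarrow> norm (b z) < 1"
    and z: "norm z < 1"
  shows "(1 - (cmod z)\<^sup>2) * (1 - cmod (b 0))\<^sup>2 \<le> 1 - (cmod (b z))\<^sup>2"
proof -
  define \<alpha> where "\<alpha> = b 0"
  have \<alpha>: "cmod \<alpha> < 1" using b1[of 0] by (simp add: \<alpha>_def)
  have lower: "1 - cmod \<alpha> \<le> cmod (1 - cnj \<alpha> * b w)" if "norm w < 1" for w
  proof -
    have "cmod (cnj \<alpha> * b w) \<le> cmod \<alpha> * 1"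
      unfolding norm_mult complex_mod_cnj using b1[OF that] by (intro mult_left_mono) auto
    then show ?thesis using norm_triangle_ineq2[of 1 "cnj \<alpha> * b w"] by simp
  qed
  then have d0: "1 - cnj \<alpha> * b w \<noteq> 0" if "norm w < 1" for w
    using \<alpha> lower[OF that] by force
  define c where "c = (\<lambda>w. (b w - \<alpha>) / (1 - cnj \<alpha> * b w))"
  have c1: "norm (c w) < 1" if w: "norm w < 1" for w
  proof -
    have "(1 - (cmod \<alpha>)\<^sup>2) * (1 - (cmod (b w))\<^sup>2) > 0"
      using \<alpha> b1[OF w] by (intro mult_pos_pos) (auto simp: abs_square_less_1)
    then have "(cmod (b w - \<alpha>))\<^sup>2 < (cmod (1 - cnj \<alpha> * b w))\<^sup>2"
      using cmod_moebius_identity[of \<alpha> "b w"] by linarith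
    then have "cmod (b w - \<alpha>) < cmod (1 - cnj \<alpha> * b w)"
      by (rule power_less_imp_less_base) simp
    then show ?thesis using d0[OF w] by (simp add: c_def norm_divide)
  qed
  have "norm (c z) \<le> norm z"
  proof (rule Schwarz_Lemma(1)[OF _ _ c1 z])
    show "c holomorphic_on ball 0 1"
      unfolding c_def using d0 by (intro holomorphic_intros hol) auto
    show "c 0 = 0" by (simp add: c_def \<alpha>_def)
  qed
  then have "cmod (b z - \<alpha>) \<le> norm z * cmod (1 - cnj \<alpha> * b z)"
    using d0[OF z] by (simp add: c_def norm_divide field_simps)
  then have "(cmod (b z - \<alpha>))\<^sup>2 \<le> (cmod z)\<^sup>2 * (cmod (1 - cnj \<alpha> * b z))\<^sup>2"
    unfolding power_mult_distrib[symmetric] by (intro power_mono) auto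
  then have "(1 - (cmod z)\<^sup>2) * (cmod (1 - cnj \<alpha> * b z))\<^sup>2 \<le> (1 - (cmod \<alpha>)\<^sup>2) * (1 - (cmod (b z))\<^sup>2)"
    using cmod_moebius_identity[of \<alpha> "b z"] by (simp add: left_diff_distrib)
  moreover have "(1 - (cmod z)\<^sup>2) * (1 - cmod \<alpha>)\<^sup>2 \<le> (1 - (cmod z)\<^sup>2) * (cmod (1 - cnj \<alpha> * b z))\<^sup>2"
    using lower[OF z] \<alpha> z by (intro mult_left_mono power_mono) (auto simp: abs_square_le_1)
  moreover have "(1 - (cmod \<alpha>)\<^sup>2) * (1 - (cmod (b z))\<^sup>2) \<le> 1 * (1 - (cmod (b z))\<^sup>2)"
    using b1[OF z] by (intro mult_right_mono) (auto simp: abs_square_le_1)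
  ultimately show ?thesis by (simp add: \<alpha>_def)
qed

context embedded_disc
begin

text \<open>
  Moving from \<open>\<xi>\<close> into the disc in a direction \<open>- \<zeta> \<xi>\<close> cannot increase the real part of
  \<open>\<langle>f z, f \<xi>\<rangle>\<close>, so \<open>Re (\<zeta> cnj A) \<ge> 0\<close> whenever \<open>Re \<zeta> > 0\<close>. Directions close to the tangent
  exclude an imaginary part of \<open>A\<close>.
\<close>

lemma crossing_coeff_real:
  assumes \<xi>: "cmod \<xi> = 1"
  shows "Im (crossing_coeff f \<xi>) = 0"
proof (rule ccontr)
  define A where "A = crossing_coeff f \<xi>"
  assume "Im (crossing_coeff f \<xi>) \<noteq> 0"
  then have nz: "Im A \<noteq> 0" by (simp add: A_def)
  \<comment> \<open>Chosen such that \<open>Re (\<zeta> cnj A) = Re A + Im \<zeta> Im A = -1\<close>.\<close>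
  define \<zeta> where "\<zeta> = Complex 1 (- ((Re A + 1) / Im A))"
  have \<zeta>: "Re \<zeta> > 0" by (simp add: \<zeta>_def)
  have p: "norm (f \<xi>) = 1" using norm_f[of \<xi>] \<xi> by simp
  have "0 \<le> Re (\<zeta> * cnj A)"
  proof (rule tendsto_lowerbound)
    show "((\<lambda>t. Re ((1 - herm (f (\<xi> - of_real t * (\<zeta> * \<xi>))) (f \<xi>)) / of_real t)) \<longlongrightarrow> Re (\<zeta> * cnj A)) (at_right 0)"
      unfolding A_def by (intro tendsto_Re one_minus_herm_boundary_quotient \<xi> \<zeta>)
    have "eventually (\<lambda>t::real. t > 0) (at_right 0)"
      by (simp add: eventually_at_filter)
    then show "eventually (\<lambda>t. 0 \<le> Re ((1 - herm (f (\<xi> - of_real t * (\<zeta> * \<xi>))) (f \<xi>)) / of_real t)) (at_right 0)"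
      using eventually_inward[OF \<xi> \<zeta>]
    proof eventually_elim
      case (elim t)
      have "norm (f (\<xi> - of_real t * (\<zeta> * \<xi>))) < 1" using f_in_ball[OF elim(2)] by simp
      then have "cmod (herm (f (\<xi> - of_real t * (\<zeta> * \<xi>))) (f \<xi>)) < 1"
        using p by (intro norm_herm_less_1) auto
      then show ?case using elim(1) complex_Re_le_cmod[of "herm (f (\<xi> - of_real t * (\<zeta> * \<xi>))) (f \<xi>)"]
        by (simp add: Re_divide_of_real)
    qed
  qed simp
  also have "Re (\<zeta> * cnj A) = -1" using nz by (simp add: \<zeta>_def)
  finally show False by simp
qed

text \<open>
  A version of the Hopf boundary point lemma: \<open>Re A\<close> is the radial derivative at \<open>\<xi>\<close> of the real part of
  \<open>b = \<langle>f z, f \<xi>\<rangle>\<close>, and \<open>1 - |b|\<^sup>2\<close> is at least a fixed multiple of \<open>1 - |z|\<^sup>2\<close>.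
\<close>

lemma crossing_coeff_pos:
  assumes \<xi>: "cmod \<xi> = 1"
  shows "Re (crossing_coeff f \<xi>) > 0"
proof -
  define p where "p = f \<xi>"
  have p: "norm p = 1" using norm_f[of \<xi>] \<xi> by (simp add: p_def)
  define b where "b = (\<lambda>z. herm (f z) p)"
  have hol: "b holomorphic_on ball 0 1"
    unfolding b_def herm_def by (intro holomorphic_intros f_holomorphic)
  have b1: "norm (b z) < 1" if "norm z < 1" for z
    unfolding b_def using f_in_ball[of z] that p by (intro norm_herm_less_1) auto
  define m where "m = (1 - cmod (b 0))\<^sup>2 / 2"
  have m: "m > 0" using b1[of 0] by (simp add: m_def)
  have "m \<le> Re (1 * cnj (crossing_coeff f \<xi>))"
  proof (rule tendsto_lowerbound)
    show "((\<lambda>t. Re ((1 - herm (f (\<xi> - of_real t * (1 * \<xi>))) (f \<xi>)) / of_real t)) \<longlongrightarrow>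
        Re (1 * cnj (crossing_coeff f \<xi>))) (at_right 0)"
      by (intro tendsto_Re one_minus_herm_boundary_quotient \<xi>) simp
    have "eventually (\<lambda>t::real. t \<in> {0<..<1}) (at_right 0)"
      by (rule eventually_at_right_real) simp
    then show "eventually (\<lambda>t. m \<le> Re ((1 - herm (f (\<xi> - of_real t * (1 * \<xi>))) (f \<xi>)) / of_real t)) (at_right 0)"
    proof eventually_elim
      case (elim t)
      define z where "z = \<xi> - of_real t * (1 * \<xi>)"
      have "z = of_real (1 - t) * \<xi>" by (simp add: z_def algebra_simps)
      then have nz: "cmod z = 1 - t" using elim \<xi> by (simp add: norm_mult del: of_real_diff)
      then have z: "norm z < 1" using elim by simp
      have "t * (1 - cmod (b 0))\<^sup>2 \<le> (1 - (cmod z)\<^sup>2) * (1 - cmod (b 0))\<^sup>2"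
        using elim unfolding nz by (intro mult_right_mono zero_le_power2) (auto simp: power2_eq_square algebra_simps)
      also have "\<dots> \<le> 1 - (cmod (b z))\<^sup>2"
        by (rule schwarz_boundary_lower_bound[OF hol b1 z])
      also have "\<dots> \<le> 2 * (1 - cmod (b z))"
        using sum_squares_bound[of 1 "cmod (b z)"] by simp
      also have "\<dots> \<le> 2 * (1 - Re (b z))"
        using complex_Re_le_cmod[of "b z"] by simp
      finally have "t * m \<le> 1 - Re (b z)" by (simp add: m_def)
      then have "m \<le> (1 - Re (b z)) / t" using elim by (simp add: field_simps)
      then show ?case
        unfolding z_def[symmetric] b_def p_def by (simp add: Re_divide_of_real)
    qed
  qed simp
  then show ?thesis using m by simp
qed

end

section \<open>Two boundary points\<close>

lemma transport_apply:
  assumes "inj_on f (ball 0 1)" "z \<in> ball 0 1"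
  shows "transport f \<phi> (f z) = \<phi> z"
  using assms by (simp add: transport_def zext_def the_inv_into_f_f)

locale comparable_discs =
  f: embedded_disc V f + g: embedded_disc W g
  for V :: "(complex ^ 'd) set" and f :: "complex \<Rightarrow> complex ^ 'd"
    and W :: "(complex ^ 'e) set" and g :: "complex \<Rightarrow> complex ^ 'e" +
  assumes M_eq: "M_emb f = M_emb g"
    and norms: "equivalent_norms_on (M_emb f) (M_emb_norm f) (M_emb_norm g)"
begin

text \<open>
  The function on the left is the value at \<open>x\<close> of a multiplier of norm at most one on \<open>W\<close>,
  pulled back to the disc. Its norm as a multiplier on \<open>V\<close> is bounded by a constant, and it
  vanishes at \<open>y\<close>, so the two-point estimate on \<open>V\<close> applies.
\<close>

lemma pseudohyperbolic_comparison:
  obtains C where "C \<ge> 0" "\<And>x y q. x \<in> ball 0 1 \<Longrightarrow> y \<in> ball 0 1 \<Longrightarrow> norm q \<le> 1 \<Longrightarrow>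
    (cmod ((herm (g x) q - herm (g y) q) / (1 - cnj (herm (g y) q) * herm (g x) q)))\<^sup>2 \<le>
    C\<^sup>2 * (1 - (1 - (norm (f x))\<^sup>2) * (1 - (norm (f y))\<^sup>2) / (cmod (1 - herm (f x) (f y)))\<^sup>2)"
proof -
  obtain a b :: real where a: "a > 0"
    and le: "\<And>\<phi>. \<phi> \<in> M_emb f \<Longrightarrow> ennreal a * M_emb_norm f \<phi> \<le> M_emb_norm g \<phi>"
    using norms unfolding equivalent_norms_on_def by blast
  show thesis
  proof
    show "1 / a \<ge> 0" using a by simp
    fix x y :: complex and q :: "complex ^ 'e"
    assume x: "x \<in> ball 0 1" and y: "y \<in> ball 0 1" and q: "norm q \<le> 1"
    define \<alpha> where "\<alpha> = herm (g y) q"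
    have \<alpha>: "cmod \<alpha> < 1"
      unfolding \<alpha>_def using g.f_in_ball[OF y] q by (intro norm_herm_less_1) auto
    define \<Phi> where "\<Phi> = (\<lambda>v. (herm v q - \<alpha>) / (1 - cnj \<alpha> * herm v q))"
    have \<Phi>: "schur_kernel_pos (ball 0 1) da_kernel \<Phi>"
      unfolding \<Phi>_def
    proof (rule schur_kernel_pos_moebius[OF schur_kernel_pos_herm[OF q] _ \<alpha>])
      show "cmod (herm v q) < 1" if "v \<in> ball 0 1" for v
        using that q by (intro norm_herm_less_1) auto
    qed
    define \<phi> where "\<phi> = zext (ball 0 1) (\<Phi> \<circ> g)"
    have tr: "transport g \<phi> = zext (g ` ball 0 1) \<Phi>"
    proof
      fix v
      show "transport g \<phi> v = zext (g ` ball 0 1) \<Phi> v"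
      proof (cases "v \<in> g ` ball 0 1")
        case True
        then obtain z where z: "z \<in> ball 0 1" "v = g z" by blast
        then show ?thesis
          using transport_apply[OF g.f_inj z(1), of \<phi>] True by (simp add: \<phi>_def zext_def)
      next
        case False
        then show ?thesis by (simp add: transport_def zext_def)
      qed
    qed
    have ext: "zext (ball 0 1) \<phi> = \<phi>" by (auto simp: \<phi>_def zext_def)
    have in_g: "\<phi> \<in> M_emb g"
      unfolding M_emb_def using schur_multiplier_M_on(1)[OF g.f_image \<Phi>] ext tr by simp
    have "M_emb_norm g \<phi> \<le> 1"
      unfolding M_emb_norm_def tr by (rule schur_multiplier_M_on(2)[OF g.f_image \<Phi>])
    then have "ennreal a * M_emb_norm f \<phi> \<le> 1"
      using le[of \<phi>] in_g M_eq by (auto intro: order.trans)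
    then have "ennreal (1 / a) * (ennreal a * M_emb_norm f \<phi>) \<le> ennreal (1 / a) * 1"
      by (rule mult_left_mono) simp
    then have norm_f: "M_on_norm (f ` ball 0 1) (transport f \<phi>) \<le> ennreal (1 / a)"
      using a by (simp add: mult.assoc[symmetric] ennreal_mult[symmetric] M_emb_norm_def)
    have "transport f \<phi> \<in> M_on (f ` ball 0 1)"
      using in_g M_eq unfolding M_emb_def by blast
    from two_point_estimate[OF f.f_image this norm_f _ imageI[OF x] imageI[OF y]]
    have "(cmod (\<phi> x))\<^sup>2 \<le> (1 / a)\<^sup>2 *
        (1 - (1 - (norm (f x))\<^sup>2) * (1 - (norm (f y))\<^sup>2) / (cmod (1 - herm (f x) (f y)))\<^sup>2)"
      using a y transport_apply[OF f.f_inj x, of \<phi>] transport_apply[OF f.f_inj y, of \<phi>]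
      by (simp add: \<phi>_def zext_def \<Phi>_def \<alpha>_def)
    moreover have "\<phi> x = \<Phi> (g x)" using x by (simp add: \<phi>_def zext_def)
    ultimately show "(cmod ((herm (g x) q - herm (g y) q) / (1 - cnj (herm (g y) q) * herm (g x) q)))\<^sup>2 \<le>
      (1 / a)\<^sup>2 * (1 - (1 - (norm (f x))\<^sup>2) * (1 - (norm (f y))\<^sup>2) / (cmod (1 - herm (f x) (f y)))\<^sup>2)"
      by (simp add: \<Phi>_def \<alpha>_def)
  qed
qed

text \<open>
  Radial approach to \<open>\<xi>\<close> and \<open>\<eta>\<close> at the speeds \<open>s\<close> and \<open>1\<close>, where \<open>s = A\<^sub>f(\<eta>) / A\<^sub>f(\<xi>)\<close> is the
  ratio for which the two image points become hyperbolically indistinguishable. The bound on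
  the test functions for \<open>g\<close> then forces the same ratio for \<open>A\<^sub>g\<close>.
\<close>

lemma crossing_coeff_proportional:
  assumes \<xi>: "cmod \<xi> = 1" and \<eta>: "cmod \<eta> = 1" and cross: "f \<xi> = f \<eta>"
  shows "Re (crossing_coeff f \<eta>) * Re (crossing_coeff g \<xi>) =
    Re (crossing_coeff f \<xi>) * Re (crossing_coeff g \<eta>)"
proof -
  define A1 where "A1 = Re (crossing_coeff f \<xi>)"
  define A2 where "A2 = Re (crossing_coeff f \<eta>)"
  define B1 where "B1 = Re (crossing_coeff g \<xi>)"
  define B2 where "B2 = Re (crossing_coeff g \<eta>)"
  have pos: "A1 > 0" "A2 > 0" "B1 > 0" "B2 > 0"
    unfolding A1_def A2_def B1_def B2_def
    by (intro f.crossing_coeff_pos g.crossing_coeff_pos \<xi> \<eta>)+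
  have A: "crossing_coeff f \<xi> = of_real A1" "crossing_coeff f \<eta> = of_real A2"
    and B: "crossing_coeff g \<xi> = of_real B1" "crossing_coeff g \<eta> = of_real B2"
    unfolding A1_def A2_def B1_def B2_def
    using f.crossing_coeff_real[OF \<xi>] f.crossing_coeff_real[OF \<eta>]
      g.crossing_coeff_real[OF \<xi>] g.crossing_coeff_real[OF \<eta>] by (simp_all add: complex_eq_iff)
  define s where "s = A2 / A1"
  have s: "s > 0" and sA: "s * A1 = A2" using pos by (simp_all add: s_def)
  define x where "x = (\<lambda>t. \<xi> - of_real t * (of_real s * \<xi>))"
  define y where "y = (\<lambda>t. \<eta> - of_real t * (of_real 1 * \<eta>))"
  define q where "q = g \<eta>"
  have q: "norm q = 1" using g.norm_f[of \<eta>] \<eta> by (simp add: q_def)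
  have in_ball: "eventually (\<lambda>t. t > 0 \<and> x t \<in> ball 0 1 \<and> y t \<in> ball 0 1) (at_right 0)"
  proof -
    have "eventually (\<lambda>t::real. t > 0) (at_right 0)" by (simp add: eventually_at_filter)
    moreover have "eventually (\<lambda>t. x t \<in> ball 0 1) (at_right 0)"
      unfolding x_def using \<xi> s by (intro eventually_inward) auto
    moreover have "eventually (\<lambda>t. y t \<in> ball 0 1) (at_right 0)"
      unfolding y_def using \<eta> by (intro eventually_inward) auto
    ultimately show ?thesis by eventually_elim simp
  qed
  define \<rho> where "\<rho> = (\<lambda>t. 1 - (1 - (norm (f (x t)))\<^sup>2) * (1 - (norm (f (y t)))\<^sup>2)
    / (cmod (1 - herm (f (x t)) (f (y t))))\<^sup>2)"
  define m where "m = (\<lambda>t. (herm (g (x t)) q - herm (g (y t)) q) /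
    (1 - cnj (herm (g (y t)) q) * herm (g (x t)) q))"
  obtain C where C: "\<And>x y. x \<in> ball 0 1 \<Longrightarrow> y \<in> ball 0 1 \<Longrightarrow>
    (cmod ((herm (g x) q - herm (g y) q) / (1 - cnj (herm (g y) q) * herm (g x) q)))\<^sup>2 \<le>
    C\<^sup>2 * (1 - (1 - (norm (f x))\<^sup>2) * (1 - (norm (f y))\<^sup>2) / (cmod (1 - herm (f x) (f y)))\<^sup>2)"
    using pseudohyperbolic_comparison q by (metis order_refl)
  \<comment> \<open>With this \<open>s\<close> all three first-order coefficients equal \<open>2 A2\<close>, so the quotient in \<open>\<rho>\<close> tends to one.\<close>
  have \<rho>_lim: "(\<rho> \<longlongrightarrow> 0) (at_right 0)"
  proof -
    have xx: "((\<lambda>t. (1 - herm (f (x t)) (f (x t))) / of_real t) \<longlongrightarrow> of_real (2 * A2)) (at_right 0)"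
      using f.one_minus_herm_quotient[OF \<xi> \<xi> s s refl] sA unfolding x_def A
      by (simp flip: of_real_mult of_real_add)
    have yy: "((\<lambda>t. (1 - herm (f (y t)) (f (y t))) / of_real t) \<longlongrightarrow> of_real (2 * A2)) (at_right 0)"
      using f.one_minus_herm_quotient[OF \<eta> \<eta> zero_less_one zero_less_one refl] unfolding y_def A
      by (simp flip: of_real_mult of_real_add)
    have xy: "((\<lambda>t. (1 - herm (f (x t)) (f (y t))) / of_real t) \<longlongrightarrow> of_real (2 * A2)) (at_right 0)"
      using f.one_minus_herm_quotient[OF \<xi> \<eta> s zero_less_one cross] sA unfolding x_def y_def A
      by (simp flip: of_real_mult of_real_add)
    have "((\<lambda>t. 1 - Re ((1 - herm (f (x t)) (f (x t))) / of_real t) * Re ((1 - herm (f (y t)) (f (y t))) / of_real t)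
        / (cmod ((1 - herm (f (x t)) (f (y t))) / of_real t))\<^sup>2) \<longlongrightarrow>
      1 - Re (of_real (2 * A2)) * Re (of_real (2 * A2)) / (cmod (of_real (2 * A2)))\<^sup>2) (at_right 0)"
      using pos by (intro tendsto_intros xx yy xy) auto
    also have "1 - Re (of_real (2 * A2)) * Re (of_real (2 * A2)) / (cmod (of_real (2 * A2)))\<^sup>2 = 0"
      using pos by (simp add: power2_eq_square)
    finally show ?thesis
    proof (rule Lim_transform_eventually)
      show "eventually (\<lambda>t. 1 - Re ((1 - herm (f (x t)) (f (x t))) / of_real t) * Re ((1 - herm (f (y t)) (f (y t))) / of_real t)
        / (cmod ((1 - herm (f (x t)) (f (y t))) / of_real t))\<^sup>2 = \<rho> t) (at_right 0)"
        using in_ball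
      proof eventually_elim
        case (elim t)
        then show ?case
          by (simp add: \<rho>_def Re_divide_of_real norm_divide power_divide herm_self power2_eq_square)
      qed
    qed
  qed
  have m_lim: "((\<lambda>t. (cmod (m t))\<^sup>2) \<longlongrightarrow> 0) (at_right 0)"
  proof (rule tendsto_sandwich[of "\<lambda>_. 0" _ _ "\<lambda>t. C\<^sup>2 * \<rho> t"])
    show "((\<lambda>t. C\<^sup>2 * \<rho> t) \<longlongrightarrow> 0) (at_right 0)"
      using tendsto_mult_left[OF \<rho>_lim, of "C\<^sup>2"] by simp
    show "eventually (\<lambda>t. (cmod (m t))\<^sup>2 \<le> C\<^sup>2 * \<rho> t) (at_right 0)"
      using in_ball by eventually_elim (simp add: C m_def \<rho>_def)
  qed auto
  have m0: "(m \<longlongrightarrow> 0) (at_right 0)"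
  proof -
    have "((\<lambda>t. sqrt ((cmod (m t))\<^sup>2)) \<longlongrightarrow> sqrt 0) (at_right 0)"
      by (intro tendsto_intros m_lim)
    then show ?thesis by (simp add: tendsto_norm_zero_iff)
  qed
  have gx: "((\<lambda>t. g (x t)) \<longlongrightarrow> g \<xi>) (at_right 0)"
    unfolding x_def using \<xi> s by (intro g.boundary_tendsto) auto
  have gy: "((\<lambda>t. g (y t)) \<longlongrightarrow> q) (at_right 0)"
    unfolding y_def q_def using \<eta> by (intro g.boundary_tendsto) auto
  have hy: "((\<lambda>t. herm (g (y t)) q) \<longlongrightarrow> 1) (at_right 0)"
    using tendsto_herm[OF gy tendsto_const[of q]] q by (simp add: herm_self)
  show ?thesis
  proof (cases "g \<xi> = q")
    case True
    have hx: "((\<lambda>t. (1 - herm (g (x t)) q) / of_real t) \<longlongrightarrow> of_real (s * B1)) (at_right 0)"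
      using g.one_minus_herm_boundary_quotient[OF \<xi>, of "of_real s"] s unfolding x_def B True
      by simp
    have hy': "((\<lambda>t. (1 - herm (g (y t)) q) / of_real t) \<longlongrightarrow> of_real B2) (at_right 0)"
      using g.one_minus_herm_boundary_quotient[OF \<eta>, of 1] unfolding y_def B q_def
      by simp
    have "((\<lambda>t. ((1 - herm (g (y t)) q) / of_real t - (1 - herm (g (x t)) q) / of_real t) /
        (cnj ((1 - herm (g (y t)) q) / of_real t) +
          cnj (herm (g (y t)) q) * ((1 - herm (g (x t)) q) / of_real t)))
      \<longlongrightarrow> (of_real B2 - of_real (s * B1)) / (cnj (of_real B2) + cnj 1 * of_real (s * B1))) (at_right 0)"
    proof (intro tendsto_intros hx hy hy')
      have "B2 + s * B1 \<noteq> 0" using pos s mult_pos_pos[of s B1] by linarith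
      then show "cnj (of_real B2) + cnj 1 * of_real (s * B1) \<noteq> 0"
        by (simp flip: of_real_mult of_real_add)
    qed
    then have "(m \<longlongrightarrow> (of_real B2 - of_real (s * B1)) / (cnj (of_real B2) + cnj 1 * of_real (s * B1))) (at_right 0)"
    proof (rule Lim_transform_eventually)
      show "eventually (\<lambda>t. ((1 - herm (g (y t)) q) / of_real t - (1 - herm (g (x t)) q) / of_real t) /
        (cnj ((1 - herm (g (y t)) q) / of_real t) +
          cnj (herm (g (y t)) q) * ((1 - herm (g (x t)) q) / of_real t)) = m t) (at_right 0)"
        using in_ball
      proof eventually_elim
        case (elim t)
        have "((1 - herm (g (y t)) q) / of_real t - (1 - herm (g (x t)) q) / of_real t) =
            (herm (g (x t)) q - herm (g (y t)) q) / of_real t"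
          by (simp add: diff_divide_distrib)
        moreover have "cnj ((1 - herm (g (y t)) q) / of_real t) +
            cnj (herm (g (y t)) q) * ((1 - herm (g (x t)) q) / of_real t) =
            (1 - cnj (herm (g (y t)) q) * herm (g (x t)) q) / of_real t"
          using elim by (simp add: field_simps)
        ultimately show ?case using elim by (simp add: m_def)
      qed
    qed
    then have "(of_real B2 - of_real (s * B1)) / (cnj (of_real B2) + cnj 1 * of_real (s * B1)) = (0 :: complex)"
      using m0 by (rule tendsto_unique[OF trivial_limit_at_right_real])
    moreover have "B2 + s * B1 \<noteq> 0" using pos s mult_pos_pos[of s B1] by linarith
    ultimately have "B2 = s * B1"
      by (simp flip: of_real_mult of_real_add of_real_diff)
    then have "A1 * B2 = A2 * B1" using sA by (simp add: mult.assoc[symmetric] mult.commute)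
    then show ?thesis by (simp add: A1_def A2_def B1_def B2_def)
  next
    case False
    define c where "c = herm (g \<xi>) q"
    have c1: "c \<noteq> 1"
    proof
      assume "c = 1"
      then have "g \<xi> \<bullet> q = 1" unfolding c_def by (simp flip: Re_herm)
      moreover have "norm (g \<xi>) = 1" using g.norm_f[of \<xi>] \<xi> by simp
      ultimately have "(norm (g \<xi> - q))\<^sup>2 = 0"
        using q by (simp add: power2_norm_eq_inner inner_diff inner_commute norm_eq_1)
      then show False using False by simp
    qed
    have hx: "((\<lambda>t. herm (g (x t)) q) \<longlongrightarrow> c) (at_right 0)"
      unfolding c_def by (intro tendsto_intros gx)
    have "(m \<longlongrightarrow> (c - 1) / (1 - cnj 1 * c)) (at_right 0)"
      unfolding m_def using c1 by (intro tendsto_intros hx hy) auto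
    then have "(c - 1) / (1 - cnj 1 * c) = 0"
      using m0 by (rule tendsto_unique[OF trivial_limit_at_right_real])
    then show ?thesis using c1 by simp
  qed
qed

end

theorem corollary3:
  fixes V :: "(complex ^ 'd) set" and W :: "(complex ^ 'e) set"
    and f :: "complex \<Rightarrow> complex ^ 'd" and g :: "complex \<Rightarrow> complex ^ 'e"
    and n :: nat and \<xi> :: "nat \<Rightarrow> complex"
  assumes "attached_disc V" and "disc_embedding V f"
    and "attached_disc W" and "disc_embedding W g"
    and "M_emb f = M_emb g"
    and "equivalent_norms_on (M_emb f) (M_emb_norm f) (M_emb_norm g)"
    and "\<And>j. j \<in> {1..n} \<Longrightarrow> \<xi> j \<in> sphere 0 1"
    and "\<And>i j. i \<in> {1..n} \<Longrightarrow> j \<in> {1..n} \<Longrightarrow> f (\<xi> i) = f (\<xi> j)"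
  shows "\<exists>c::real. c > 0 \<and>
    (\<forall>j\<in>{1..n}. crossing_coeff f (\<xi> j) = complex_of_real c * crossing_coeff g (\<xi> j))"
proof -
  interpret comparable_discs V f W g
    using assms by unfold_locales
  have \<xi>: "cmod (\<xi> j) = 1" if "j \<in> {1..n}" for j using assms(7)[OF that] by simp
  show ?thesis
  proof (cases "n = 0")
    case True
    then show ?thesis by (intro exI[of _ 1]) simp
  next
    case False
    then have 1: "1 \<in> {1..n}" by simp
    define c where "c = Re (crossing_coeff f (\<xi> 1)) / Re (crossing_coeff g (\<xi> 1))"
    note posf = f.crossing_coeff_pos[OF \<xi>[OF 1]] and posg = g.crossing_coeff_pos[OF \<xi>[OF 1]]
    have "crossing_coeff f (\<xi> j) = complex_of_real c * crossing_coeff g (\<xi> j)" if j: "j \<in> {1..n}" for j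
    proof -
      have "Re (crossing_coeff f (\<xi> j)) * Re (crossing_coeff g (\<xi> 1)) =
          Re (crossing_coeff f (\<xi> 1)) * Re (crossing_coeff g (\<xi> j))"
        by (rule crossing_coeff_proportional[OF \<xi>[OF 1] \<xi>[OF j] assms(8)[OF 1 j]])
      then have "Re (crossing_coeff f (\<xi> j)) = c * Re (crossing_coeff g (\<xi> j))"
        using posg by (simp add: c_def field_simps)
      then show ?thesis
        using f.crossing_coeff_real[OF \<xi>[OF j]] g.crossing_coeff_real[OF \<xi>[OF j]]
        by (simp add: complex_eq_iff)
    qed
    moreover have "c > 0" using posf posg by (simp add: c_def)
    ultimately show ?thesis by blast
  qed
qed

end
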